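(* Let $\beta<\eta<\alpha$. If $$K\,\mathrm{Lip}_uG\,\Big(\frac{1}{\eta-\beta}+\frac{1}{\alpha-\eta}\Big)<1,$$ then there exists a Lipschitz invariant stable manifold for the random partial differential equation $$\frac{du}{dt}=Au+z(\theta_t\omega)u+G(\theta_t\omega,u),\qquad u(0)=u_0\in H,$$ which is given by $$M^s(\omega)=\{\xi+h^s(\xi,\omega)\;|\;\xi\in H^-\},\qquad \omega\in\Omega,$$ where $M^s(\omega)=\{u_0\in H\;|\;u(\cdot,\omega,u_0)\in C_\eta^+\}$ and, for each $\omega\in\Omega$, $h^s(\cdot,\omega):H^-\to H^+$ is a Lipschitz continuous mapping with $h^s(0,\omega)=0$.
   Context: **State space and linear part.** $H$ is an infinite dimensional separable Hilbert space with norm $|\cdot|$. The linear operator $A:D(A)\to H$ generates a strongly continuous semigroup $e^{At}$ on $H$ satisfying an exponential dichotomy with exponents $\alpha>\beta$ and bound $K$: there is a continuous projection $P^+$ on $H$ such that (i) $P^+e^{At}=e^{At}P^+$; (ii) for $t\ge 0$ the restriction $e^{At}|_{R(P^+)}$ is an isomorphism of the range $R(P^+)$ onto itself, and $e^{At}$ for $t<0$ is defined on $R(P^+)$ as the inverse map; (iii) $|e^{At}P^+x|\le Ke^{\alpha t}|x|$ for $t\le 0$ and $|e^{At}P^-x|\le Ke^{\beta t}|x|$ for $t\ge 0$, where $P^-=I-P^+$. Put $H^-=P^-H$ (stable subspace), $H^+=P^+H$ (unstable subspace), so $H=H^+\oplus H^-$. **Nonlinearity.** $F:H\to H$ satisfies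 $F(0)=0$ and $|P^\pm(F(x_1)-F(x_2))|\le \mathrm{Lip}F\,|x_1-x_2|$ for all $x_1,x_2\in H$, with Lipschitz constant $\mathrm{Lip}F>0$. **Noise.** Let $C_0(\mathbb R,\mathbb R)$ be the continuous functions $\omega:\mathbb R\to\mathbb R$ with $\omega(0)=0$, with the compact open topology, its Borel $\sigma$-algebra and the (two-sided) Wiener measure $\mathbb P$, and let $\theta_t\omega=\omega(\cdot+t)-\omega(t)$. $\Omega\subset C_0(\mathbb R,\mathbb R)$ is a Borel set of $\mathbb P$-measure one with $\theta_t\Omega=\Omega$ for all $t\in\mathbb R$, such that for $\omega\in\Omega$: $\omega(t)/t\to0$ as $t\to\pm\infty$; $z(\omega)=-\int_{-\infty}^0e^\tau\omega(\tau)\,d\tau$ exists; $t\mapsto z(\theta_t\omega)$ is continuous (it is the stationary solution of $dz+z\,dt=dW$, $W(t)=\omega(t)$); and $|z(\theta_t\omega)|/|t|\to0$, $\frac1t\int_0^tz(\theta_\tau\omega)\,d\tau\to0$ as $t\to\pm\infty$. $\mathcal F$ is the trace on $\Omega$ of the Borel $\sigma$-algebra, and $\mathbb P$ is restricted to $\mathcal F$. **Random PDE.** $G(\omega,u)=e^{-z(\omega)}F(e^{z(\omega)}u)$. For every $\omega$, $G(\omega,\cdot)$ satisfies the same Lipschitz estimate as $F$, and $\mathrm{Lip}_uG$ $(=\mathrm{Lip}F)$ denotes the Lipschitz constant of $G$ with respect to $u$: $|P^\pm(G(\omega,x_1)-G(\omega,x_2))|\le\mathrm{Lip}_uG\,|x_1-x_2|$.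 For each $\omega\in\Omega$ and $u_0\in H$, $u(t,\omega,u_0)$, $t\ge0$, is the unique mild solution $$u(t)=e^{At+\int_0^tz(\theta_\tau\omega)d\tau}u_0+\int_0^te^{A(t-s)+\int_s^tz(\theta_r\omega)dr}G(\theta_s\omega,u(s))\,ds.$$ The map $(t,\omega,x)\mapsto u(t,\omega,x)$ is a random dynamical system on $H$ over $\theta$ (measurable, $u(0,\omega,x)=x$, $u(t_1+t_2,\omega,x)=u(t_2,\theta_{t_1}\omega,u(t_1,\omega,x))$). **Function space.** For $\beta<\eta<\alpha$ (and given $\omega$), $C_\eta^+$ is the Banach space of continuous $\phi:[0,\infty)\to H$ with $|\phi|_{C_\eta^+}=\sup_{t\ge0}e^{-\eta t-\int_0^tz(\theta_\tau\omega)d\tau}|\phi(t)|<\infty$. **Invariant manifolds.** A random set is a family $M=\{M(\omega)\}_{\omega\in\Omega}$ of nonempty closed subsets of $H$ such that $\omega\mapsto\inf_{y\in M(\omega)}|x-y|$ is a random variable for every $x\in H$. It is invariant for a random dynamical system $\phi$ if $\phi(t,\omega,M(\omega))\subset M(\theta_t\omega)$ for all $t\ge0$. An invariant random set of the form $M(\omega)=\{\xi+h(\xi,\omega)\,|\,\xi\in H^-\}$ with $h(\cdot,\omega):H^-\to H^+$ Lipschitz is called a Lipschitz stable manifold. A stable manifold for the random PDE means one for the random dynamical system $u$. *)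

theory Defs
  imports "HOL-Probability.Probability"
begin

section \<open>Semigroups and exponential dichotomies\<close>

definition C0_semigroup :: "(real \<Rightarrow> 'a::real_normed_vector \<Rightarrow> 'a) \<Rightarrow> bool" where
  "C0_semigroup T \<longleftrightarrow>
     (\<forall>t\<ge>0. bounded_linear (T t)) \<and>
     (\<forall>x. T 0 x = x) \<and>
     (\<forall>s\<ge>0. \<forall>t\<ge>0. \<forall>x. T (s + t) x = T s (T t x)) \<and>
     (\<forall>x. continuous_on {0..} (\<lambda>t. T t x))"

text \<open>An unbounded operator is given by its domain \<open>D\<close> and a total function \<open>A\<close> whose values
  outside \<open>D\<close> are irrelevant.\<close>

definition generates_semigroup ::
  "'a set \<Rightarrow> ('a \<Rightarrow> 'a) \<Rightarrow> (real \<Rightarrow> 'a::real_normed_vector \<Rightarrow> 'a) \<Rightarrow> bool" where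
  "generates_semigroup D A T \<longleftrightarrow>
     C0_semigroup T \<and>
     D = {x. \<exists>y. ((\<lambda>t. (T t x - x) /\<^sub>R t) \<longlongrightarrow> y) (at_right 0)} \<and>
     (\<forall>x\<in>D. ((\<lambda>t. (T t x - x) /\<^sub>R t) \<longlongrightarrow> A x) (at_right 0))"

text \<open>For \<open>t < 0\<close>, \<open>group_on S T t\<close> is the inverse of \<open>T (-t)\<close> restricted to \<open>S\<close>;
  it is only meaningful on \<open>S\<close>.\<close>

definition group_on :: "'a set \<Rightarrow> (real \<Rightarrow> 'a \<Rightarrow> 'a) \<Rightarrow> real \<Rightarrow> 'a \<Rightarrow> 'a" where
  "group_on S T t = (if t \<ge> 0 then T t else inv_into S (T (- t)))"

text \<open>\<open>Pp\<close> is the projection onto the unstable subspace. The restriction of \<open>T t\<close> to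
  \<open>range Pp\<close> is bounded and linear, and the first estimate bounds its inverse, so bijectivity is
  all that remains to be required of an isomorphism.\<close>

definition exponential_dichotomy ::
  "(real \<Rightarrow> 'a::real_normed_vector \<Rightarrow> 'a) \<Rightarrow> ('a \<Rightarrow> 'a) \<Rightarrow> real \<Rightarrow> real \<Rightarrow> real \<Rightarrow> bool" where
  "exponential_dichotomy T Pp \<alpha> \<beta> K \<longleftrightarrow>
     \<alpha> > \<beta> \<and>
     bounded_linear Pp \<and> (\<forall>x. Pp (Pp x) = Pp x) \<and>
     (\<forall>t\<ge>0. \<forall>x. Pp (T t x) = T t (Pp x)) \<and>
     (\<forall>t\<ge>0. bij_betw (T t) (range Pp) (range Pp)) \<and>
     (\<forall>t\<le>0. \<forall>x. norm (group_on (range Pp) T t (Pp x)) \<le> K * exp (\<alpha> * t) * norm x) \<and>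
     (\<forall>t\<ge>0. \<forall>x. norm (T t (x - Pp x)) \<le> K * exp (\<beta> * t) * norm x)"


section \<open>Wiener space\<close>

definition C0_paths :: "(real \<Rightarrow> real) set" where
  "C0_paths = {\<omega>. continuous_on UNIV \<omega> \<and> \<omega> 0 = 0}"

definition compact_open_C0 :: "(real \<Rightarrow> real) topology" where
  "compact_open_C0 =
     topology_generated_by {{\<omega>\<in>C0_paths. \<omega> ` C \<subseteq> U} | C U. compact C \<and> open U}"

definition borel_C0 :: "(real \<Rightarrow> real) measure" where
  "borel_C0 = sigma C0_paths {U. openin compact_open_C0 U}"

text \<open>Two-sided Wiener measure, as the law on path space under which the coordinate process is a
  two-sided Brownian motion (paths are continuous and vanish at \<open>0\<close> by the choice of the space).\<close>

definition wiener_measure :: "(real \<Rightarrow> real) measure \<Rightarrow> bool" where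
  "wiener_measure W \<longleftrightarrow>
     prob_space W \<and> space W = C0_paths \<and> sets W = sets borel_C0 \<and>
     (\<forall>s t. s < t \<longrightarrow>
        distributed W lborel (\<lambda>\<omega>. \<omega> t - \<omega> s) (\<lambda>x. ennreal (normal_density 0 (sqrt (t - s)) x))) \<and>
     (\<forall>(\<tau>::nat \<Rightarrow> real) n. strict_mono \<tau> \<longrightarrow>
        prob_space.indep_vars W (\<lambda>_. borel) (\<lambda>i \<omega>. \<omega> (\<tau> (Suc i)) - \<omega> (\<tau> i)) {..<n})"

definition wiener_shift :: "real \<Rightarrow> (real \<Rightarrow> real) \<Rightarrow> real \<Rightarrow> real" where
  "wiener_shift t \<omega> = (\<lambda>s. \<omega> (s + t) - \<omega> t)"

definition ou :: "(real \<Rightarrow> real) \<Rightarrow> real" where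
  "ou \<omega> = - (LBINT \<tau>=-\<infinity>..0. exp \<tau> * \<omega> \<tau>)"

text \<open>The interval integral is signed, so this is also meaningful for \<open>t < s\<close>.\<close>

definition ou_integral :: "(real \<Rightarrow> real) \<Rightarrow> real \<Rightarrow> real \<Rightarrow> real" where
  "ou_integral \<omega> s t = (LBINT r=ereal s..ereal t. ou (wiener_shift r \<omega>))"

definition admissible_noise :: "(real \<Rightarrow> real) measure \<Rightarrow> (real \<Rightarrow> real) set \<Rightarrow> bool" where
  "admissible_noise W \<Omega> \<longleftrightarrow>
     \<Omega> \<in> sets W \<and> emeasure W \<Omega> = 1 \<and>
     (\<forall>t. wiener_shift t ` \<Omega> = \<Omega>) \<and>
     (\<forall>\<omega>\<in>\<Omega>.
        ((\<lambda>t. \<omega> t / t) \<longlongrightarrow> 0) at_top \<and> ((\<lambda>t. \<omega> t / t) \<longlongrightarrow> 0) at_bot \<and>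
        interval_lebesgue_integrable lborel (-\<infinity>) 0 (\<lambda>\<tau>. exp \<tau> * \<omega> \<tau>) \<and>
        continuous_on UNIV (\<lambda>t. ou (wiener_shift t \<omega>)) \<and>
        ((\<lambda>t. \<bar>ou (wiener_shift t \<omega>)\<bar> / \<bar>t\<bar>) \<longlongrightarrow> 0) at_top \<and>
        ((\<lambda>t. \<bar>ou (wiener_shift t \<omega>)\<bar> / \<bar>t\<bar>) \<longlongrightarrow> 0) at_bot \<and>
        ((\<lambda>t. ou_integral \<omega> 0 t / t) \<longlongrightarrow> 0) at_top \<and>
        ((\<lambda>t. ou_integral \<omega> 0 t / t) \<longlongrightarrow> 0) at_bot)"


section \<open>The random evolution equation\<close>

definition conj_nonlin :: "('a::real_vector \<Rightarrow> 'a) \<Rightarrow> (real \<Rightarrow> real) \<Rightarrow> 'a \<Rightarrow> 'a" where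
  "conj_nonlin F \<omega> x = exp (- ou \<omega>) *\<^sub>R F (exp (ou \<omega>) *\<^sub>R x)"

text \<open>\<open>T t\<close> is \<open>e\<^sup>A\<^sup>t\<close>; only the values of \<open>\<phi>\<close> on \<open>[0,\<infinity>)\<close> matter.\<close>

definition mild_solution ::
  "(real \<Rightarrow> 'a::{real_inner,banach,second_countable_topology} \<Rightarrow> 'a) \<Rightarrow> ('a \<Rightarrow> 'a) \<Rightarrow>
    (real \<Rightarrow> real) \<Rightarrow> 'a \<Rightarrow> (real \<Rightarrow> 'a) \<Rightarrow> bool" where
  "mild_solution T F \<omega> x \<phi> \<longleftrightarrow>
     continuous_on {0..} \<phi> \<and>
     (\<forall>t\<ge>0. \<phi> t = exp (ou_integral \<omega> 0 t) *\<^sub>R T t x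
        + (LBINT s=0..ereal t.
             exp (ou_integral \<omega> s t) *\<^sub>R T (t - s) (conj_nonlin F (wiener_shift s \<omega>) (\<phi> s))))"

definition unique_mild_solution ::
  "(real \<Rightarrow> 'a::{real_inner,banach,second_countable_topology} \<Rightarrow> 'a) \<Rightarrow> ('a \<Rightarrow> 'a) \<Rightarrow>
    (real \<Rightarrow> real) \<Rightarrow> 'a \<Rightarrow> (real \<Rightarrow> 'a) \<Rightarrow> bool" where
  "unique_mild_solution T F \<omega> x \<phi> \<longleftrightarrow>
     mild_solution T F \<omega> x \<phi> \<and> (\<forall>\<psi>. mild_solution T F \<omega> x \<psi> \<longrightarrow> (\<forall>t\<ge>0. \<psi> t = \<phi> t))"

definition C_eta_plus :: "real \<Rightarrow> (real \<Rightarrow> real) \<Rightarrow> (real \<Rightarrow> 'a::real_normed_vector) set" where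
  "C_eta_plus \<eta> \<omega> =
     {\<phi>. continuous_on {0..} \<phi> \<and>
         bdd_above ((\<lambda>t. exp (- \<eta> * t - ou_integral \<omega> 0 t) * norm (\<phi> t)) ` {0..})}"


section \<open>Random dynamical systems and stable manifolds\<close>

text \<open>Below \<open>Pr\<close> is a measure whose space is the set of noise paths; the base flow is
  the Wiener shift.\<close>

definition random_dynamical_system ::
  "(real \<Rightarrow> real) measure \<Rightarrow> (real \<Rightarrow> (real \<Rightarrow> real) \<Rightarrow> 'a::topological_space \<Rightarrow> 'a) \<Rightarrow> bool" where
  "random_dynamical_system Pr u \<longleftrightarrow>
     (\<lambda>(t, \<omega>, x). u t \<omega> x) \<in> (restrict_space borel {0..} \<Otimes>\<^sub>M Pr \<Otimes>\<^sub>M borel) \<rightarrow>\<^sub>M borel \<and>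
     (\<forall>\<omega>\<in>space Pr. \<forall>x. u 0 \<omega> x = x) \<and>
     (\<forall>\<omega>\<in>space Pr. \<forall>t1\<ge>0. \<forall>t2\<ge>0. \<forall>x.
        u (t1 + t2) \<omega> x = u t2 (wiener_shift t1 \<omega>) (u t1 \<omega> x))"

definition random_set :: "(real \<Rightarrow> real) measure \<Rightarrow> ((real \<Rightarrow> real) \<Rightarrow> 'a::metric_space set) \<Rightarrow> bool" where
  "random_set Pr M \<longleftrightarrow>
     (\<forall>\<omega>\<in>space Pr. M \<omega> \<noteq> {} \<and> closed (M \<omega>)) \<and>
     (\<forall>x. (\<lambda>\<omega>. infdist x (M \<omega>)) \<in> borel_measurable Pr)"

definition invariant_under ::
  "(real \<Rightarrow> real) measure \<Rightarrow> (real \<Rightarrow> (real \<Rightarrow> real) \<Rightarrow> 'a \<Rightarrow> 'a) \<Rightarrow>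
    ((real \<Rightarrow> real) \<Rightarrow> 'a set) \<Rightarrow> bool" where
  "invariant_under Pr u M \<longleftrightarrow>
     (\<forall>t\<ge>0. \<forall>\<omega>\<in>space Pr. u t \<omega> ` M \<omega> \<subseteq> M (wiener_shift t \<omega>))"

text \<open>\<open>M\<close> is a Lipschitz stable manifold over \<open>Hm\<close> with values in \<open>Hp\<close>, given as the graph of
  \<open>h\<close>; the Lipschitz constant may depend on \<open>\<omega>\<close>.\<close>

definition lipschitz_stable_manifold ::
  "(real \<Rightarrow> real) measure \<Rightarrow> (real \<Rightarrow> (real \<Rightarrow> real) \<Rightarrow> 'a::real_normed_vector \<Rightarrow> 'a) \<Rightarrow>
    'a set \<Rightarrow> 'a set \<Rightarrow> ('a \<Rightarrow> (real \<Rightarrow> real) \<Rightarrow> 'a) \<Rightarrow> ((real \<Rightarrow> real) \<Rightarrow> 'a set) \<Rightarrow> bool" where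
  "lipschitz_stable_manifold Pr u Hm Hp h M \<longleftrightarrow>
     random_set Pr M \<and> invariant_under Pr u M \<and>
     (\<forall>\<omega>\<in>space Pr.
        (\<forall>\<xi>\<in>Hm. h \<xi> \<omega> \<in> Hp) \<and>
        (\<exists>L. L-lipschitz_on Hm (\<lambda>\<xi>. h \<xi> \<omega>)) \<and>
        M \<omega> = {\<xi> + h \<xi> \<omega> | \<xi>. \<xi> \<in> Hm})"

end

theory Submission
  imports Defs
begin

text \<open>Multiplying a solution by the exponential of minus the integrated noise removes the term
  \<open>z u\<close> from the equation and turns the weight of the path space into \<open>exp (- \<eta> * t)\<close>. The noise
  survives only in a positive factor \<open>c s\<close> by which the argument of \<open>F\<close> is multiplied and its value is
  divided, and this leaves the Lipschitz constant alone. So, for each noise path, the claim is about a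
  deterministic nonautonomous equation.

  For that equation the method of Lyapunov and Perron applies. A path that grows at most like
  \<open>exp (\<eta> * t)\<close> solves the mild equation exactly when it is a fixed point of the operator that adds to
  the stable orbit of \<open>\<xi>\<close> the convolution of the forcing with the Green function of the dichotomy
  (\<open>lp_fixed_point_mild\<close>, \<open>mild_lp_fixed_point\<close>): its unstable component must be an integral over the
  future, for otherwise a part growing at least like \<open>exp (\<alpha> * t)\<close> would remain
  (\<open>unstable_orbit_zero\<close>). The gap condition says that this operator is a contraction in the weighted
  norm (\<open>lp_operator_diff\<close>). Its unique fixed point depends on \<open>\<xi>\<close> in a Lipschitz way
  (\<open>lp_fixed_point_lipschitz\<close>), and the manifold consists of the values of the fixed points at time
  \<open>0\<close>: it is the graph of their unstable components.

  Invariance is the cocycle property together with the additivity of the integrated noise. For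
  measurability in the noise the fixed point is built as a pointwise limit of Picard iterates, which are
  jointly measurable in time and noise (\<open>measurable_stable_orbit\<close>); this is why measurable paths, and not
  continuous ones, are iterated. The distance to the graph is then an infimum over a countable dense set
  of base points (\<open>measurable_infdist_graph\<close>).\<close>

section \<open>Joint measurability and an exponential integral\<close>

text \<open>A Caratheodory function is jointly measurable: freezing the time at the last multiple of
  \<open>1/n\<close> leaves countably many measurable pieces, and continuity in time lets \<open>n\<close> tend to infinity.\<close>

lemma measurable_caratheodory:
  fixes f :: "real \<Rightarrow> 'x \<Rightarrow> 'b::metric_space"
  assumes meas: "\<And>t. f t \<in> borel_measurable M"
    and cont: "\<And>x. x \<in> space M \<Longrightarrow> continuous_on UNIV (\<lambda>t. f t x)"
  shows "(\<lambda>(t, x). f t x) \<in> borel_measurable (borel \<Otimes>\<^sub>M M)"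
proof (rule borel_measurable_LIMSEQ_metric)
  fix n :: nat
  have "(\<lambda>p. f (real_of_int \<lfloor>real (Suc n) * fst p\<rfloor> / real (Suc n)) (snd p))
    \<in> borel_measurable (borel \<Otimes>\<^sub>M M)"
  proof (rule measurable_compose_countable
      [where f = "\<lambda>i p. f (real_of_int i / real (Suc n)) (snd p)"
        and g = "\<lambda>p. \<lfloor>real (Suc n) * fst p\<rfloor>"])
    show "(\<lambda>p. f (real_of_int i / real (Suc n)) (snd p)) \<in> borel_measurable (borel \<Otimes>\<^sub>M M)" for i
      by (rule measurable_compose[OF measurable_snd meas])
    show "(\<lambda>p. \<lfloor>real (Suc n) * fst p\<rfloor>) \<in> measurable (borel \<Otimes>\<^sub>M M) (count_space UNIV)"
      by measurable
  qed
  then show "(\<lambda>(t, x). f (real_of_int \<lfloor>real (Suc n) * t\<rfloor> / real (Suc n)) x)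
    \<in> borel_measurable (borel \<Otimes>\<^sub>M M)"
    by (simp add: case_prod_unfold)
next
  fix p assume p: "p \<in> space (borel \<Otimes>\<^sub>M M :: (real \<times> 'x) measure)"
  obtain t x where px: "p = (t, x)" by force
  with p have x: "x \<in> space M" by (simp add: space_pair_measure)
  have "(\<lambda>n. real_of_int \<lfloor>real (Suc n) * t\<rfloor> / real (Suc n)) \<longlonglongrightarrow> t"
  proof (rule LIMSEQ_I)
    fix e :: real assume "0 < e"
    then obtain N where N: "inverse (real (Suc N)) < e" using reals_Archimedean by blast
    have "norm (real_of_int \<lfloor>real (Suc n) * t\<rfloor> / real (Suc n) - t) < e" if "n \<ge> N" for n
    proof -
      have "real_of_int \<lfloor>real (Suc n) * t\<rfloor> / real (Suc n) - t
        = (real_of_int \<lfloor>real (Suc n) * t\<rfloor> - real (Suc n) * t) / real (Suc n)"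
        by (simp add: field_simps)
      moreover have "\<bar>real_of_int \<lfloor>real (Suc n) * t\<rfloor> - real (Suc n) * t\<bar> \<le> 1" by linarith
      ultimately have "norm (real_of_int \<lfloor>real (Suc n) * t\<rfloor> / real (Suc n) - t) \<le> 1 / real (Suc n)"
        by (simp add: abs_divide divide_right_mono del: of_nat_Suc)
      also have "\<dots> \<le> 1 / real (Suc N)" using that by (intro divide_left_mono) auto
      finally show ?thesis using N by (simp add: inverse_eq_divide)
    qed
    then show "\<exists>no. \<forall>n\<ge>no. norm (real_of_int \<lfloor>real (Suc n) * t\<rfloor> / real (Suc n) - t) < e" by blast
  qed
  with cont[OF x] have "(\<lambda>n. f (real_of_int \<lfloor>real (Suc n) * t\<rfloor> / real (Suc n)) x) \<longlonglongrightarrow> f t x"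
    by (auto simp: continuous_on_eq_continuous_at intro: isCont_tendsto_compose)
  then show "(\<lambda>n. case p of (t, x) \<Rightarrow> f (real_of_int \<lfloor>real (Suc n) * t\<rfloor> / real (Suc n)) x)
    \<longlonglongrightarrow> (case p of (t, x) \<Rightarrow> f t x)"
    by (simp add: px)
qed

lemma has_bochner_integral_exp_half_line:
  fixes a :: real
  assumes "0 < a"
  shows "has_bochner_integral lborel (\<lambda>x. indicator {0..} x * exp (- (a * x))) (1 / a)"
proof -
  have "has_bochner_integral lborel (\<lambda>x. exp (- x) * indicator {0..} x :: real) 1"
    using has_bochner_integral_I0i_power_exp_m'[of 0] by simp
  then have "has_bochner_integral lborel (\<lambda>x. exp (- (0 + a * x)) * indicator {0..} (0 + a * x) :: real)
      (1 /\<^sub>R \<bar>a\<bar>)"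
    using assms by (subst (asm) lborel_has_bochner_integral_real_affine_iff[where c = a and t = 0]) auto
  moreover have "exp (- (0 + a * x)) * indicator {0..} (0 + a * x)
      = indicator {0..} x * exp (- (a * x))" for x :: real
    using assms by (auto simp: indicator_def zero_le_mult_iff)
  ultimately show ?thesis using assms by (simp only: divide_inverse real_scaleR_def abs_of_pos mult_ac)
qed

text \<open>The two reciprocals in the gap condition are the masses, on the two half-lines, of the weighted
  decay rate that the dichotomy gives for the Green kernel.\<close>

lemma has_bochner_integral_dichotomy_rate:
  fixes \<alpha> \<beta> \<eta> t :: real
  assumes "\<beta> < \<eta>" "\<eta> < \<alpha>"
  shows "has_bochner_integral lborel
    (\<lambda>s. min (exp (\<alpha> * (t - s))) (exp (\<beta> * (t - s))) * exp (\<eta> * s))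
    (exp (\<eta> * t) * (1 / (\<eta> - \<beta>) + 1 / (\<alpha> - \<eta>)))"
proof -
  define k where "k = (\<lambda>r. min (exp (\<alpha> * r)) (exp (\<beta> * r)) * exp (- (\<eta> * r)))"
  have neg: "has_bochner_integral lborel (\<lambda>x. indicator {0..} (0 + - 1 * x) * exp (- ((\<alpha> - \<eta>) * (0 + - 1 * x))))
      ((1 / (\<alpha> - \<eta>)) /\<^sub>R \<bar>- 1\<bar>)"
    by (subst lborel_has_bochner_integral_real_affine_iff[where c = "-1" and t = 0, symmetric])
      (use has_bochner_integral_exp_half_line[of "\<alpha> - \<eta>"] assms in auto)
  have "has_bochner_integral lborel
     (\<lambda>x. indicator {0..} x * exp (- ((\<eta> - \<beta>) * x))
        + indicator {0..} (0 + - 1 * x) * exp (- ((\<alpha> - \<eta>) * (0 + - 1 * x))))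
     (1 / (\<eta> - \<beta>) + (1 / (\<alpha> - \<eta>)) /\<^sub>R \<bar>- 1\<bar>)"
    by (rule has_bochner_integral_add[OF has_bochner_integral_exp_half_line neg]) (use assms in simp)
  moreover have "AE x in lborel. indicator {0..} x * exp (- ((\<eta> - \<beta>) * x))
        + indicator {0..} (0 + - 1 * x) * exp (- ((\<alpha> - \<eta>) * (0 + - 1 * x))) = k x"
  proof (rule AE_mp[OF AE_lborel_singleton[of 0]], rule AE_I2, rule impI)
    fix x :: real assume "x \<noteq> 0"
    have "\<beta> * x \<le> \<alpha> * x" if "x > 0" using assms that by simp
    moreover have "\<alpha> * x \<le> \<beta> * x" if "x < 0" using assms that by simp
    ultimately show "indicator {0..} x * exp (- ((\<eta> - \<beta>) * x))
        + indicator {0..} (0 + - 1 * x) * exp (- ((\<alpha> - \<eta>) * (0 + - 1 * x))) = k x"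
      using \<open>x \<noteq> 0\<close> by (auto simp: k_def indicator_def min_def algebra_simps simp flip: exp_add)
  qed
  ultimately have "has_bochner_integral lborel k (1 / (\<eta> - \<beta>) + 1 / (\<alpha> - \<eta>))"
    by (subst (asm) has_bochner_integral_cong_AE[where g = k]) (auto simp: k_def)
  then have "has_bochner_integral lborel (\<lambda>s. k (t + - 1 * s)) (1 / (\<eta> - \<beta>) + 1 / (\<alpha> - \<eta>))"
    by (subst (asm) lborel_has_bochner_integral_real_affine_iff[where c = "-1" and t = t]) auto
  then have "has_bochner_integral lborel (\<lambda>s. exp (\<eta> * t) * k (t + - 1 * s))
      (exp (\<eta> * t) * (1 / (\<eta> - \<beta>) + 1 / (\<alpha> - \<eta>)))"
    by (rule has_bochner_integral_mult_right) 
  moreover have "exp (\<eta> * t) * k (t + - 1 * s)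
      = min (exp (\<alpha> * (t - s))) (exp (\<beta> * (t - s))) * exp (\<eta> * s)" for s
  proof -
    have "exp (\<eta> * t) * exp (- (\<eta> * (t + - 1 * s))) = exp (\<eta> * s)"
      by (simp add: algebra_simps flip: exp_add)
    then show ?thesis unfolding k_def by (simp add: algebra_simps)
  qed
  ultimately show ?thesis by simp
qed

section \<open>Semigroups with an exponential dichotomy\<close>

locale dichotomous_semigroup =
  fixes T :: "real \<Rightarrow> 'a::{real_inner,banach,second_countable_topology} \<Rightarrow> 'a"
    and Pp :: "'a \<Rightarrow> 'a" and \<alpha> \<beta> K :: real
  assumes semigroup: "C0_semigroup T"
    and dichotomy: "exponential_dichotomy T Pp \<alpha> \<beta> K"
    and K_nonneg: "0 \<le> K"
begin

text \<open>Both flows are frozen at time \<open>0\<close> outside the half-line on which the dichotomy bounds them, so that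
  they are continuous in time on the whole line.\<close>

definition unstable_flow :: "real \<Rightarrow> 'a \<Rightarrow> 'a" where
  "unstable_flow r x = group_on (range Pp) T (min 0 r) (Pp x)"

definition stable_flow :: "real \<Rightarrow> 'a \<Rightarrow> 'a" where
  "stable_flow r x = T (max 0 r) (x - Pp x)"

text \<open>This is the Green function of the linear equation on the whole line: convolution with it gives
  the solution of the inhomogeneous equation that grows at most at a rate between \<open>\<beta>\<close> and \<open>\<alpha>\<close>.\<close>

definition green :: "real \<Rightarrow> 'a \<Rightarrow> 'a" where
  "green r x = (if 0 \<le> r then stable_flow r x else - unstable_flow r x)"

lemma linear_T: "0 \<le> t \<Longrightarrow> bounded_linear (T t)"
  and T_0: "T 0 x = x"
  and T_add: "\<lbrakk>0 \<le> s; 0 \<le> t\<rbrakk> \<Longrightarrow> T (s + t) x = T s (T t x)"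
  and continuous_T: "continuous_on {0..} (\<lambda>t. T t x)"
  using semigroup by (auto simp: C0_semigroup_def)

lemma linear_Pp: "bounded_linear Pp"
  and Pp_idem: "Pp (Pp x) = Pp x"
  and Pp_T: "0 \<le> t \<Longrightarrow> Pp (T t x) = T t (Pp x)"
  and bij_T: "0 \<le> t \<Longrightarrow> bij_betw (T t) (range Pp) (range Pp)"
  and norm_group_on: "t \<le> 0 \<Longrightarrow> norm (group_on (range Pp) T t (Pp x)) \<le> K * exp (\<alpha> * t) * norm x"
  and norm_T_Pm: "0 \<le> t \<Longrightarrow> norm (T t (x - Pp x)) \<le> K * exp (\<beta> * t) * norm x"
  and beta_less_alpha: "\<beta> < \<alpha>"
  using dichotomy by (auto simp: exponential_dichotomy_def)

lemma range_Pp_iff: "x \<in> range Pp \<longleftrightarrow> Pp x = x"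
  using Pp_idem by (metis rangeE rangeI)

lemma Pp_Pm: "Pp (x - Pp x) = 0"
  by (simp add: linear_diff[OF bounded_linear.linear[OF linear_Pp]] Pp_idem)

lemma continuous_T_max: "continuous_on UNIV (\<lambda>t. T (max 0 t) x)"
  by (rule continuous_on_compose2[OF continuous_T]) (auto intro!: continuous_intros)

lemma unstable_flow_range: "Pp (unstable_flow r x) = unstable_flow r x"
  and T_unstable_flow_inverse: "r \<le> 0 \<Longrightarrow> T (- r) (unstable_flow r x) = Pp x"
proof -
  have *: "T (- r) ` range Pp = range Pp" if "r < 0"
    using bij_T[of "- r"] that by (simp add: bij_betw_def)
  have "inv_into (range Pp) (T (- r)) (Pp x) \<in> range Pp" if "r < 0"
    using *[OF that] by (intro inv_into_into) auto
  then show "Pp (unstable_flow r x) = unstable_flow r x"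
    unfolding range_Pp_iff[symmetric] by (auto simp: unstable_flow_def group_on_def T_0 min_def)
  have "T (- r) (inv_into (range Pp) (T (- r)) (Pp x)) = Pp x" if "r < 0"
    using *[OF that] by (intro f_inv_into_f) auto
  then show "T (- r) (unstable_flow r x) = Pp x" if "r \<le> 0"
    using that by (auto simp: unstable_flow_def group_on_def T_0 min_def)
qed

text \<open>The semigroup is injective on the unstable subspace; this pins down the backward flow there, and
  its linearity and cocycle property are read off from this characterisation.\<close>

lemma unstable_flow_unique:
  assumes "r \<le> 0" "Pp y = y" "T (- r) y = Pp x"
  shows "unstable_flow r x = y"
proof -
  have "inj_on (T (- r)) (range Pp)" using bij_T[of "- r"] assms(1) by (simp add: bij_betw_def)
  then show ?thesis
    by (rule inj_onD) (use assms T_unstable_flow_inverse unstable_flow_range range_Pp_iff in auto)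
qed

lemma unstable_flow_shift:
  assumes "0 \<le> s" "s \<le> r"
  shows "T s (unstable_flow (- r) x) = unstable_flow (s - r) x"
proof (rule unstable_flow_unique[symmetric])
  show "Pp (T s (unstable_flow (- r) x)) = T s (unstable_flow (- r) x)"
    using assms by (simp add: Pp_T unstable_flow_range)
  have "T (- (s - r)) (T s (unstable_flow (- r) x)) = T (- (s - r) + s) (unstable_flow (- r) x)"
    using assms by (intro T_add[symmetric]) auto
  then show "T (- (s - r)) (T s (unstable_flow (- r) x)) = Pp x"
    using assms T_unstable_flow_inverse[of "- r"] by simp
qed (use assms in auto)

lemma T_unstable_flow:
  assumes "0 \<le> s" "s \<le> t"
  shows "T t (unstable_flow (- s) x) = T (t - s) (Pp x)"
  using T_add[of "t - s" s "unstable_flow (- s) x"] T_unstable_flow_inverse[of "- s" x] assms by simp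

lemma unstable_flow_T:
  assumes "0 \<le> t"
  shows "unstable_flow (- t) (T t x) = Pp x"
  by (rule unstable_flow_unique) (use assms in \<open>auto simp: Pp_T Pp_idem\<close>)

lemma norm_unstable_flow: "r \<le> 0 \<Longrightarrow> norm (unstable_flow r x) \<le> K * exp (\<alpha> * r) * norm (Pp x)"
  using norm_group_on[of r "Pp x"] by (simp add: unstable_flow_def Pp_idem)

lemma norm_stable_flow: "0 \<le> r \<Longrightarrow> norm (stable_flow r x) \<le> K * exp (\<beta> * r) * norm (x - Pp x)"
  using norm_T_Pm[of r "x - Pp x"] by (simp add: stable_flow_def Pp_Pm)

lemma linear_unstable_flow: "bounded_linear (unstable_flow r)"
proof -
  define q where "q = min 0 r"
  have q: "q \<le> 0" by (simp add: q_def)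
  have eq: "unstable_flow r = unstable_flow q" by (auto simp: unstable_flow_def q_def)
  have lin: "unstable_flow q (x + y) = unstable_flow q x + unstable_flow q y"
    "unstable_flow q (a *\<^sub>R x) = a *\<^sub>R unstable_flow q x" for x y a
    by (rule unstable_flow_unique; use q in \<open>simp add: unstable_flow_range T_unstable_flow_inverse
        bounded_linear.linear[OF linear_Pp] bounded_linear.linear[OF linear_T] linear_add linear_scale\<close>)+
  show ?thesis unfolding eq
    by (rule bounded_linear_intro[where K = "K * exp (\<alpha> * q)"])
      (use q lin norm_group_on[OF q] in \<open>auto simp: unstable_flow_def min_def mult_ac\<close>)
qed

lemma linear_stable_flow: "bounded_linear (stable_flow r)"
  unfolding stable_flow_def
  by (intro bounded_linear_compose[OF linear_T] bounded_linear_sub bounded_linear_ident linear_Pp) simp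

lemma linear_green: "bounded_linear (green r)"
  using linear_stable_flow[of r] bounded_linear_minus[OF linear_unstable_flow[of r]]
  by (cases "0 \<le> r") (simp_all add: green_def [abs_def])

lemma continuous_stable_flow: "continuous_on UNIV (\<lambda>r. stable_flow r x)"
  unfolding stable_flow_def by (rule continuous_T_max)

text \<open>On \<open>[-n, \<infinity>)\<close> the backward flow is the forward orbit of a single earlier point, so that strong
  continuity of the semigroup carries over to negative times.\<close>

lemma continuous_unstable_flow: "continuous_on UNIV (\<lambda>r. unstable_flow r x)"
proof -
  have "isCont (\<lambda>r. unstable_flow r x) r" for r
  proof -
    define a where "a = \<bar>r\<bar> + 1"
    have "continuous_on {-a<..} (\<lambda>r. T (max 0 (a + min 0 r)) (unstable_flow (- a) x))"
      by (rule continuous_on_compose2[OF continuous_T_max]) (auto intro!: continuous_intros)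
    moreover have "T (max 0 (a + min 0 r')) (unstable_flow (- a) x) = unstable_flow r' x"
      if "r' \<in> {-a<..}" for r'
    proof -
      have "T (a + min 0 r') (unstable_flow (- a) x) = unstable_flow (a + min 0 r' - a) x"
        using that by (intro unstable_flow_shift) (auto simp: a_def)
      then show ?thesis using that by (simp add: unstable_flow_def a_def)
    qed
    ultimately have "continuous_on {-a<..} (\<lambda>r. unstable_flow r x)" by (rule continuous_on_eq)
    then show ?thesis by (rule continuous_on_interior) (auto simp: interior_open a_def)
  qed
  then show ?thesis by (simp add: continuous_at_imp_continuous_on)
qed

lemma isCont_green:
  assumes "r \<noteq> 0"
  shows "isCont (\<lambda>r. green r x) r"
proof (cases "0 < r")
  case True
  have "continuous_on {0<..} (\<lambda>r. green r x)"
    using continuous_on_subset[OF continuous_stable_flow subset_UNIV]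
    by (rule continuous_on_eq) (simp add: green_def)
  with True show ?thesis by (auto intro: continuous_on_interior simp: interior_open)
next
  case False
  have "continuous_on {..<0} (\<lambda>r. green r x)"
    using continuous_on_minus[OF continuous_on_subset[OF continuous_unstable_flow subset_UNIV]]
    by (rule continuous_on_eq) (simp add: green_def)
  with False assms show ?thesis by (auto intro: continuous_on_interior simp: interior_open)
qed

lemma measurable_stable_flow [measurable]:
  "(\<lambda>(r, x). stable_flow r x) \<in> borel_measurable (borel \<Otimes>\<^sub>M borel)"
  by (rule measurable_caratheodory)
    (auto intro: continuous_stable_flow borel_measurable_continuous_onI linear_continuous_on linear_stable_flow)

lemma measurable_unstable_flow [measurable]:
  "(\<lambda>(r, x). unstable_flow r x) \<in> borel_measurable (borel \<Otimes>\<^sub>M borel)"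
  by (rule measurable_caratheodory)
    (auto intro: continuous_unstable_flow borel_measurable_continuous_onI linear_continuous_on linear_unstable_flow)

lemma measurable_green [measurable]:
  "(\<lambda>(r, x). green r x) \<in> borel_measurable (borel \<Otimes>\<^sub>M borel)"
  unfolding green_def by measurable

lemma norm_green:
  assumes "norm (Pp x) \<le> b" "norm (x - Pp x) \<le> b"
  shows "norm (green r x) \<le> K * b * min (exp (\<alpha> * r)) (exp (\<beta> * r))"
proof (cases "0 \<le> r")
  case True
  then have "min (exp (\<alpha> * r)) (exp (\<beta> * r)) = exp (\<beta> * r)"
    using beta_less_alpha by (simp add: min_absorb2 mult_right_mono)
  moreover have "K * exp (\<beta> * r) * norm (x - Pp x) \<le> K * exp (\<beta> * r) * b"
    using assms K_nonneg by (intro mult_left_mono) auto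
  ultimately show ?thesis using norm_stable_flow[OF True, of x] True by (simp add: green_def mult_ac)
next
  case False
  then have "min (exp (\<alpha> * r)) (exp (\<beta> * r)) = exp (\<alpha> * r)"
    using beta_less_alpha by (simp add: min_absorb1 mult_right_mono_neg)
  moreover have "K * exp (\<alpha> * r) * norm (Pp x) \<le> K * exp (\<alpha> * r) * b"
    using assms K_nonneg by (intro mult_left_mono) auto
  ultimately show ?thesis using norm_unstable_flow[of r x] False by (simp add: green_def mult_ac)
qed

end

section \<open>The Lyapunov--Perron fixed point\<close>

text \<open>If the bound \<open>D\<close> can be replaced by \<open>b + q * D\<close>, then it can be replaced by the fixed point of
  that map. The least bound shows this without iterating.\<close>

lemma bound_by_contraction:
  fixes a :: "'x \<Rightarrow> real"
  assumes "q < 1" "X \<noteq> {}" "\<And>x. x \<in> X \<Longrightarrow> a x \<le> D0"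
    and step: "\<And>D. (\<forall>x\<in>X. a x \<le> D) \<Longrightarrow> (\<forall>x\<in>X. a x \<le> b + q * D)"
    and "x \<in> X"
  shows "a x \<le> b / (1 - q)"
proof -
  define D where "D = (SUP x\<in>X. a x)"
  have bdd: "bdd_above (a ` X)" using assms(3) by (rule bdd_aboveI2)
  then have "\<forall>x\<in>X. a x \<le> D" by (auto simp: D_def intro: cSUP_upper)
  from step[OF this] have "D \<le> b + q * D"
    unfolding D_def using assms(2) by (intro cSUP_least) auto
  then have "D \<le> b / (1 - q)" using assms(1) by (simp add: field_simps)
  moreover have "a x \<le> D" using bdd assms(5) by (auto simp: D_def intro: cSUP_upper)
  ultimately show ?thesis by linarith
qed

locale lyapunov_perron = dichotomous_semigroup T Pp \<alpha> \<beta> K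
  for T :: "real \<Rightarrow> 'a::{real_inner,banach,second_countable_topology} \<Rightarrow> 'a"
    and Pp :: "'a \<Rightarrow> 'a" and \<alpha> \<beta> K :: real +
  fixes F :: "'a \<Rightarrow> 'a" and L \<eta> :: real
  assumes F_0: "F 0 = 0"
    and L_pos: "0 < L"
    and lipschitz_Pp: "\<And>x y. norm (Pp (F x - F y)) \<le> L * norm (x - y)"
    and lipschitz_Pm: "\<And>x y. norm ((F x - F y) - Pp (F x - F y)) \<le> L * norm (x - y)"
    and rate: "\<beta> < \<eta>" "\<eta> < \<alpha>"
    and gap: "K * L * (1 / (\<eta> - \<beta>) + 1 / (\<alpha> - \<eta>)) < 1"
begin

definition contraction :: real where
  "contraction = K * L * (1 / (\<eta> - \<beta>) + 1 / (\<alpha> - \<eta>))"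

text \<open>The noise enters the equation, after it has been scaled by the integrated noise, only through the
  positive function \<open>c\<close>. Scaling the nonlinearity in this way changes neither its zero nor its
  Lipschitz constant.\<close>

definition scaled_nonlin :: "(real \<Rightarrow> real) \<Rightarrow> real \<Rightarrow> 'a \<Rightarrow> 'a" where
  "scaled_nonlin c s x = F (c s *\<^sub>R x) /\<^sub>R c s"

definition scaling :: "(real \<Rightarrow> real) \<Rightarrow> bool" where
  "scaling c \<longleftrightarrow> c \<in> borel_measurable borel \<and> (\<forall>s. 0 < c s)"

text \<open>Only measurability is required of a path, so that pointwise limits of Picard iterates qualify
  without further ado; fixed points turn out to be continuous.\<close>

definition growth :: "(real \<Rightarrow> 'a) \<Rightarrow> bool" where
  "growth v \<longleftrightarrow> v \<in> borel_measurable borel \<and> (\<exists>C. \<forall>t\<ge>0. norm (v t) \<le> C * exp (\<eta> * t))"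

definition lp_operator :: "(real \<Rightarrow> real) \<Rightarrow> 'a \<Rightarrow> (real \<Rightarrow> 'a) \<Rightarrow> real \<Rightarrow> 'a" where
  "lp_operator c \<xi> v t = T (max 0 t) \<xi> +
     (LINT s|lborel. indicator {0<..} s *\<^sub>R green (t - s) (scaled_nonlin c s (v s)))"

primrec picard :: "(real \<Rightarrow> real) \<Rightarrow> 'a \<Rightarrow> nat \<Rightarrow> real \<Rightarrow> 'a" where
  "picard c \<xi> 0 = (\<lambda>_. 0)"
| "picard c \<xi> (Suc n) = lp_operator c \<xi> (picard c \<xi> n)"

definition stable_orbit :: "(real \<Rightarrow> real) \<Rightarrow> 'a \<Rightarrow> real \<Rightarrow> 'a" where
  "stable_orbit c \<xi> t = lim (\<lambda>n. picard c \<xi> n t)"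

lemma contraction_bounds: "0 \<le> contraction" "contraction < 1"
  using gap K_nonneg L_pos rate by (auto simp: contraction_def)

lemma continuous_F: "continuous_on UNIV F"
proof -
  have "(2 * L)-lipschitz_on UNIV F"
  proof (rule lipschitz_onI)
    fix x y :: 'a
    have "norm (F x - F y) \<le> norm (Pp (F x - F y)) + norm ((F x - F y) - Pp (F x - F y))"
      using norm_triangle_ineq[of "Pp (F x - F y)" "(F x - F y) - Pp (F x - F y)"] by simp
    then show "dist (F x) (F y) \<le> 2 * L * dist x y"
      using lipschitz_Pp[of x y] lipschitz_Pm[of x y] by (simp add: dist_norm)
  qed (use L_pos in simp)
  then show ?thesis by (rule lipschitz_on_continuous_on)
qed

lemma measurable_F [measurable]: "F \<in> borel_measurable borel"
  using continuous_F by (rule borel_measurable_continuous_onI)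

lemma measurable_scaled_nonlin:
  assumes [measurable]: "c \<in> borel_measurable borel" "v \<in> borel_measurable borel"
  shows "(\<lambda>s. scaled_nonlin c s (v s)) \<in> borel_measurable borel"
  unfolding scaled_nonlin_def by measurable

lemma scaled_nonlin_0: "scaled_nonlin c s 0 = 0"
  by (simp add: scaled_nonlin_def F_0)

lemma scaled_nonlin_lipschitz:
  fixes x y :: 'a and s :: real
  assumes "scaling c"
  defines "d \<equiv> scaled_nonlin c s x - scaled_nonlin c s y"
  shows "norm (Pp d) \<le> L * norm (x - y)" "norm (d - Pp d) \<le> L * norm (x - y)"
proof -
  have c: "0 < c s" using assms by (simp add: scaling_def)
  define e where "e = F (c s *\<^sub>R x) - F (c s *\<^sub>R y)"
  have d: "d = e /\<^sub>R c s"
    by (simp add: d_def e_def scaled_nonlin_def scaleR_diff_right)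
  have Pd: "Pp d = Pp e /\<^sub>R c s"
    unfolding d by (rule linear_scale[OF bounded_linear.linear[OF linear_Pp]])
  have n: "norm (c s *\<^sub>R x - c s *\<^sub>R y) = c s * norm (x - y)"
    using c by (simp flip: scaleR_diff_right)
  show "norm (Pp d) \<le> L * norm (x - y)"
    using lipschitz_Pp[of "c s *\<^sub>R x" "c s *\<^sub>R y"] c n unfolding Pd e_def
    by (simp add: divide_inverse[symmetric] field_simps)
  have "d - Pp d = (e - Pp e) /\<^sub>R c s"
    by (subst Pd, subst d) (simp add: scaleR_diff_right)
  then have "norm (d - Pp d) = norm (e - Pp e) / c s"
    using c by (simp add: divide_inverse mult.commute)
  moreover have "norm (e - Pp e) \<le> L * norm (x - y) * c s"
    using lipschitz_Pm[of "c s *\<^sub>R x" "c s *\<^sub>R y"] unfolding n e_def by (simp only: mult_ac)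
  ultimately show "norm (d - Pp d) \<le> L * norm (x - y)"
    using c by (simp add: pos_divide_le_eq)
qed

lemma norm_green_scaled_nonlin_diff:
  assumes "scaling c" "norm (x - y) \<le> D * exp (\<eta> * s)"
  shows "norm (green (t - s) (scaled_nonlin c s x) - green (t - s) (scaled_nonlin c s y))
    \<le> K * L * D * (min (exp (\<alpha> * (t - s))) (exp (\<beta> * (t - s))) * exp (\<eta> * s))"
proof -
  define d where "d = scaled_nonlin c s x - scaled_nonlin c s y"
  have "green (t - s) (scaled_nonlin c s x) - green (t - s) (scaled_nonlin c s y) = green (t - s) d"
    unfolding d_def by (rule linear_diff[OF bounded_linear.linear[OF linear_green], symmetric])
  moreover have "L * norm (x - y) \<le> L * (D * exp (\<eta> * s))"
    using assms(2) L_pos by simp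
  then have "norm (green (t - s) d)
      \<le> K * (L * (D * exp (\<eta> * s))) * min (exp (\<alpha> * (t - s))) (exp (\<beta> * (t - s)))"
    using scaled_nonlin_lipschitz[OF assms(1), of s x y]
    by (intro norm_green) (auto simp: d_def)
  ultimately show ?thesis by (simp add: mult_ac)
qed

lemma measurable_green_scaled_nonlin:
  assumes [measurable]: "c \<in> borel_measurable borel" "v \<in> borel_measurable borel"
  shows "(\<lambda>s. indicator {0<..} s *\<^sub>R green (t - s) (scaled_nonlin c s (v s))) \<in> borel_measurable borel"
proof -
  note measurable_scaled_nonlin[OF assms, measurable]
  show ?thesis by measurable
qed

text \<open>Convolution with the Green kernel contracts the norm with weight \<open>exp (\<eta> * t)\<close>.\<close>

lemma green_integral_diff:
  assumes c: "scaling c" and [measurable]: "v \<in> borel_measurable borel" "w \<in> borel_measurable borel"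
    and D: "\<And>s. 0 \<le> s \<Longrightarrow> norm (v s - w s) \<le> D * exp (\<eta> * s)"
  defines "f \<equiv> \<lambda>t s. indicator {0<..} s *\<^sub>R green (t - s) (scaled_nonlin c s (v s))
      - indicator {0<..} s *\<^sub>R green (t - s) (scaled_nonlin c s (w s))"
  shows "integrable lborel (f t)" "norm (LINT s|lborel. f t s) \<le> contraction * D * exp (\<eta> * t)"
proof -
  have cm: "c \<in> borel_measurable borel" using c by (simp add: scaling_def)
  define g where "g = (\<lambda>s. K * L * D * (min (exp (\<alpha> * (t - s))) (exp (\<beta> * (t - s))) * exp (\<eta> * s)))"
  have D0: "0 \<le> D" using order_trans[OF norm_ge_zero D[of 0]] by simp
  have g: "has_bochner_integral lborel g (K * L * D * (exp (\<eta> * t) * (1 / (\<eta> - \<beta>) + 1 / (\<alpha> - \<eta>))))"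
    unfolding g_def by (intro has_bochner_integral_mult_right has_bochner_integral_dichotomy_rate rate)
  have fm: "f t \<in> borel_measurable lborel"
    unfolding f_def measurable_lborel2
    by (intro borel_measurable_diff measurable_green_scaled_nonlin cm assms)
  have le: "norm (f t s) \<le> g s" for s
  proof (cases "0 < s")
    case True
    then show ?thesis
      using norm_green_scaled_nonlin_diff[OF c D, of s t] by (simp add: f_def g_def)
  next
    case False
    then show ?thesis using D0 K_nonneg L_pos by (simp add: f_def g_def)
  qed
  show int: "integrable lborel (f t)"
    by (rule Bochner_Integration.integrable_bound[OF _ fm, of g])
      (use g in \<open>auto simp: has_bochner_integral_iff intro!: AE_I2 order_trans[OF le]\<close>)
  have "norm (LINT s|lborel. f t s) \<le> (LINT s|lborel. g s)"
    using g le int by (intro Bochner_Integration.integral_norm_bound_integral) (simp_all add: has_bochner_integral_iff)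
  also have "\<dots> = contraction * D * exp (\<eta> * t)"
    using g by (simp add: has_bochner_integral_iff contraction_def mult_ac)
  finally show "norm (LINT s|lborel. f t s) \<le> contraction * D * exp (\<eta> * t)" .
qed

lemma growthE:
  assumes "growth v"
  obtains C where "v \<in> borel_measurable borel" "\<And>t. 0 \<le> t \<Longrightarrow> norm (v t) \<le> C * exp (\<eta> * t)"
  using assms by (auto simp: growth_def)

lemma growth_diff_bound:
  assumes "growth v" "growth w"
  obtains D where "\<And>t. 0 \<le> t \<Longrightarrow> norm (v t - w t) \<le> D * exp (\<eta> * t)"
proof -
  obtain C C' where "\<And>t. 0 \<le> t \<Longrightarrow> norm (v t) \<le> C * exp (\<eta> * t)"
      "\<And>t. 0 \<le> t \<Longrightarrow> norm (w t) \<le> C' * exp (\<eta> * t)"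
    using assms by (auto simp: growth_def)
  then have "norm (v t - w t) \<le> (C + C') * exp (\<eta> * t)" if "0 \<le> t" for t
    using norm_triangle_ineq4[of "v t" "w t"] that by (fastforce simp: algebra_simps)
  then show ?thesis using that by blast
qed

lemma integrable_green:
  assumes "scaling c" "growth v"
  shows "integrable lborel (\<lambda>s. indicator {0<..} s *\<^sub>R green (t - s) (scaled_nonlin c s (v s)))"
proof -
  obtain C where "v \<in> borel_measurable borel" "\<And>t. 0 \<le> t \<Longrightarrow> norm (v t) \<le> C * exp (\<eta> * t)"
    using growthE[OF assms(2)] by blast
  from green_integral_diff(1)[OF assms(1) this(1), of "\<lambda>_. 0" C t] this(2) show ?thesis
    by (simp add: scaled_nonlin_0 linear_0[OF bounded_linear.linear[OF linear_green]])
qed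

lemma norm_T_stable:
  assumes "Pp \<xi> = 0" "0 \<le> t"
  shows "norm (T t \<xi>) \<le> K * norm \<xi> * exp (\<eta> * t)"
proof -
  have "norm (T t \<xi>) \<le> K * exp (\<beta> * t) * norm \<xi>" using norm_T_Pm[OF assms(2), of \<xi>] assms by simp
  also have "\<dots> \<le> K * exp (\<eta> * t) * norm \<xi>"
    using assms rate K_nonneg by (intro mult_left_mono mult_right_mono) (auto intro: mult_right_mono)
  finally show ?thesis by (simp add: mult_ac)
qed

lemma lp_operator_diff:
  assumes c: "scaling c" and "growth v" "growth w" and "Pp \<xi> = 0" "Pp \<zeta> = 0"
    and D: "\<And>s. 0 \<le> s \<Longrightarrow> norm (v s - w s) \<le> D * exp (\<eta> * s)" and "0 \<le> t"
  shows "norm (lp_operator c \<xi> v t - lp_operator c \<zeta> w t)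
    \<le> (K * norm (\<xi> - \<zeta>) + contraction * D) * exp (\<eta> * t)"
proof -
  let ?f = "\<lambda>v s. indicator {0<..} s *\<^sub>R green (t - s) (scaled_nonlin c s (v s))"
  have "T t \<xi> - T t \<zeta> = T t (\<xi> - \<zeta>)"
    using linear_T[OF assms(7)] by (simp add: linear_diff bounded_linear.linear)
  moreover have "Pp (\<xi> - \<zeta>) = 0"
    using assms by (simp add: linear_diff[OF bounded_linear.linear[OF linear_Pp]])
  then have "norm (T t (\<xi> - \<zeta>)) \<le> K * norm (\<xi> - \<zeta>) * exp (\<eta> * t)"
    using assms(7) by (rule norm_T_stable)
  moreover have "(LINT s|lborel. ?f v s) - (LINT s|lborel. ?f w s) = (LINT s|lborel. ?f v s - ?f w s)"
    by (rule Bochner_Integration.integral_diff[symmetric]; rule integrable_green) fact+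
  then have "norm ((LINT s|lborel. ?f v s) - (LINT s|lborel. ?f w s)) \<le> contraction * D * exp (\<eta> * t)"
    using green_integral_diff(2)[OF c _ _ D, of t] assms(2,3) by (simp add: growth_def)
  moreover have eq: "lp_operator c \<xi> v t - lp_operator c \<zeta> w t
      = (T t \<xi> - T t \<zeta>) + ((LINT s|lborel. ?f v s) - (LINT s|lborel. ?f w s))"
    using assms(7) by (simp add: lp_operator_def)
  ultimately show ?thesis
    unfolding eq distrib_right by (intro norm_triangle_mono) simp_all
qed

text \<open>With \<open>\<xi> = \<zeta>\<close> this is uniqueness of the fixed point.\<close>

lemma lp_fixed_point_lipschitz:
  assumes c: "scaling c" and v: "growth v" and w: "growth w" and "Pp \<xi> = 0" "Pp \<zeta> = 0"
    and "\<And>t. 0 \<le> t \<Longrightarrow> lp_operator c \<xi> v t = v t"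
    and "\<And>t. 0 \<le> t \<Longrightarrow> lp_operator c \<zeta> w t = w t"
    and "0 \<le> t"
  shows "norm (v t - w t) \<le> K * norm (\<xi> - \<zeta>) / (1 - contraction) * exp (\<eta> * t)"
proof -
  obtain D0 where D0: "\<And>t. 0 \<le> t \<Longrightarrow> norm (v t - w t) \<le> D0 * exp (\<eta> * t)"
    using growth_diff_bound[OF v w] by blast
  define a where "a = (\<lambda>t. norm (v t - w t) * exp (- (\<eta> * t)))"
  have a: "a t \<le> D \<longleftrightarrow> norm (v t - w t) \<le> D * exp (\<eta> * t)" for t D
    by (simp add: a_def exp_minus field_simps)
  have "a t \<le> K * norm (\<xi> - \<zeta>) / (1 - contraction)"
  proof (rule bound_by_contraction[where X = "{0..}" and a = a])
    show "contraction < 1" by (rule contraction_bounds)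
    show "a t \<le> D0" if "t \<in> {0..}" for t using D0[of t] that by (simp add: a)
    fix D assume "\<forall>t\<in>{0..}. a t \<le> D"
    then have "norm (v t - w t) \<le> D * exp (\<eta> * t)" if "0 \<le> t" for t using that by (simp add: a)
    then have "norm (v t - w t) \<le> (K * norm (\<xi> - \<zeta>) + contraction * D) * exp (\<eta> * t)" if "0 \<le> t" for t
      using lp_operator_diff[OF c v w assms(4,5), of D t] assms(6,7) that by simp
    then show "\<forall>t\<in>{0..}. a t \<le> K * norm (\<xi> - \<zeta>) + contraction * D" by (simp add: a)
  qed (use assms in auto)
  then show ?thesis by (simp add: a)
qed

text \<open>The parameter \<open>\<omega>\<close> carries measurability in the noise along the Picard iteration: the time integral
  of a jointly measurable function depends measurably on the remaining variables.\<close>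

lemma measurable_lp_operator:
  assumes [measurable]: "(\<lambda>(\<omega>, s). c \<omega> s) \<in> borel_measurable (M \<Otimes>\<^sub>M borel)"
    "(\<lambda>(\<omega>, s). v \<omega> s) \<in> borel_measurable (M \<Otimes>\<^sub>M borel)"
  shows "(\<lambda>(\<omega>, t). lp_operator (c \<omega>) \<xi> (v \<omega>) t) \<in> borel_measurable (M \<Otimes>\<^sub>M borel)"
proof -
  have [measurable]: "(\<lambda>t. T (max 0 t) \<xi>) \<in> borel_measurable borel"
    by (rule borel_measurable_continuous_onI[OF continuous_T_max])
  have [measurable]: "sets lborel = sets borel" by simp
  have "(\<lambda>p. LINT s|lborel. indicator {0<..} s *\<^sub>R
      green (snd p - s) (F (c (fst p) s *\<^sub>R v (fst p) s) /\<^sub>R c (fst p) s))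
    \<in> borel_measurable (M \<Otimes>\<^sub>M borel)"
    by (rule lborel.borel_measurable_lebesgue_integral) measurable
  then show ?thesis
    unfolding lp_operator_def scaled_nonlin_def case_prod_unfold by measurable
qed

lemma measurable_picard:
  assumes "(\<lambda>(\<omega>, s). c \<omega> s) \<in> borel_measurable (M \<Otimes>\<^sub>M borel)"
  shows "(\<lambda>(\<omega>, t). picard (c \<omega>) \<xi> n t) \<in> borel_measurable (M \<Otimes>\<^sub>M borel)"
  by (induction n) (use measurable_lp_operator[OF assms] in auto)

lemma measurable_stable_orbit:
  assumes "(\<lambda>(\<omega>, s). c \<omega> s) \<in> borel_measurable (M \<Otimes>\<^sub>M borel)"
  shows "(\<lambda>(\<omega>, t). stable_orbit (c \<omega>) \<xi> t) \<in> borel_measurable (M \<Otimes>\<^sub>M borel)"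
  using borel_measurable_lim_metric[OF measurable_picard[OF assms]]
  unfolding stable_orbit_def by (simp add: case_prod_unfold)

lemma measurable_path:
  assumes "c \<in> borel_measurable borel"
  shows "picard c \<xi> n \<in> borel_measurable borel" "stable_orbit c \<xi> \<in> borel_measurable borel"
proof -
  have c: "(\<lambda>(\<omega>, s). c s) \<in> borel_measurable (borel \<Otimes>\<^sub>M borel :: (real \<times> real) measure)"
    using assms by measurable
  have 1: "Pair 0 \<in> borel \<rightarrow>\<^sub>M (borel \<Otimes>\<^sub>M borel :: (real \<times> real) measure)" by measurable
  show "picard c \<xi> n \<in> borel_measurable borel"
    using measurable_compose[OF 1 measurable_picard[OF c]] by simp
  show "stable_orbit c \<xi> \<in> borel_measurable borel"
    using measurable_compose[OF 1 measurable_stable_orbit[OF c]] by simp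
qed

lemma picard_step:
  assumes c: "scaling c" and \<xi>: "Pp \<xi> = 0"
  shows "growth (picard c \<xi> n) \<and> (\<forall>t\<ge>0. norm (picard c \<xi> (Suc n) t - picard c \<xi> n t)
      \<le> K * norm \<xi> * contraction ^ n * exp (\<eta> * t))"
proof (induction n)
  case 0
  have "growth (picard c \<xi> 0)" by (auto simp: growth_def intro!: exI[of _ 0])
  moreover have "lp_operator c \<xi> (\<lambda>_. 0) t = T t \<xi>" if "0 \<le> t" for t
    using that by (simp add: lp_operator_def scaled_nonlin_0 linear_0[OF bounded_linear.linear[OF linear_green]])
  ultimately show ?case using norm_T_stable[OF \<xi>] by simp
next
  case (Suc n)
  have cm: "c \<in> borel_measurable borel" using c by (simp add: scaling_def)
  obtain C where C: "\<And>t. 0 \<le> t \<Longrightarrow> norm (picard c \<xi> n t) \<le> C * exp (\<eta> * t)"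
    using Suc by (auto simp: growth_def)
  have g: "growth (picard c \<xi> (Suc n))" unfolding growth_def
  proof (intro conjI exI allI impI)
    show "picard c \<xi> (Suc n) \<in> borel_measurable borel" by (rule measurable_path[OF cm])
    fix t :: real assume t: "0 \<le> t"
    then have "norm (picard c \<xi> (Suc n) t) \<le> norm (picard c \<xi> (Suc n) t - picard c \<xi> n t) + norm (picard c \<xi> n t)"
      using norm_triangle_ineq[of "picard c \<xi> (Suc n) t - picard c \<xi> n t" "picard c \<xi> n t"] by simp
    also have "\<dots> \<le> K * norm \<xi> * contraction ^ n * exp (\<eta> * t) + C * exp (\<eta> * t)"
      using Suc C t by (intro add_mono) auto
    finally show "norm (picard c \<xi> (Suc n) t) \<le> (K * norm \<xi> * contraction ^ n + C) * exp (\<eta> * t)"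
      by (simp add: algebra_simps)
  qed
  have "norm (picard c \<xi> (Suc (Suc n)) t - picard c \<xi> (Suc n) t)
      \<le> K * norm \<xi> * contraction ^ Suc n * exp (\<eta> * t)" if "0 \<le> t" for t
  proof -
    have "norm (lp_operator c \<xi> (picard c \<xi> (Suc n)) t - lp_operator c \<xi> (picard c \<xi> n) t)
      \<le> (K * norm (\<xi> - \<xi>) + contraction * (K * norm \<xi> * contraction ^ n)) * exp (\<eta> * t)"
      by (rule lp_operator_diff[OF c g _ \<xi> \<xi> _ that]) (use Suc in auto)
    then show ?thesis by (simp add: mult_ac)
  qed
  with g show ?case by blast
qed

text \<open>The Picard iterates form a geometric series at each time, with constants that are uniform in the
  weighted norm.\<close>

lemma picard_limit:
  assumes c: "scaling c" and \<xi>: "Pp \<xi> = 0" and t: "0 \<le> t"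
  shows "norm (stable_orbit c \<xi> t - picard c \<xi> n t)
    \<le> K * norm \<xi> / (1 - contraction) * contraction ^ n * exp (\<eta> * t)"
proof -
  define B where "B = K * norm \<xi> * exp (\<eta> * t)"
  define d where "d = (\<lambda>k. picard c \<xi> (Suc k) t - picard c \<xi> k t)"
  have d: "norm (d k) \<le> B * contraction ^ k" for k
    using conjunct2[OF picard_step[OF c \<xi>, of k], rule_format, OF t] by (simp add: d_def B_def mult_ac)
  have geo: "(\<lambda>k. B * contraction ^ (k + n)) sums (B * contraction ^ n / (1 - contraction))" for n
    using sums_mult[OF geometric_sums[of contraction], of "B * contraction ^ n"] contraction_bounds
    by (simp add: power_add mult_ac)
  have sd: "summable d"
    by (rule summable_comparison_test'[OF sums_summable[OF geo[of 0]], of 0]) (use d in simp)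
  have tele: "(\<Sum>k<n. d k) = picard c \<xi> n t" for n
    unfolding d_def by (induction n) auto
  have "(\<lambda>n. picard c \<xi> n t) \<longlonglongrightarrow> suminf d"
    using summable_LIMSEQ[OF sd] by (simp add: tele)
  then have orbit: "stable_orbit c \<xi> t = suminf d"
    unfolding stable_orbit_def by (rule limI)
  have "stable_orbit c \<xi> t - picard c \<xi> n t = (\<Sum>k. d (k + n))"
    using suminf_split_initial_segment[OF sd, of n] by (simp add: orbit tele)
  also have "norm \<dots> \<le> (\<Sum>k. B * contraction ^ (k + n))"
    by (rule norm_suminf_le[OF d sums_summable[OF geo]])
  also have "\<dots> = B * contraction ^ n / (1 - contraction)"
    using geo by (rule sums_unique[symmetric])
  finally show ?thesis by (simp add: B_def mult_ac)
qed

lemma stable_orbit_growth: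
  assumes c: "scaling c" and \<xi>: "Pp \<xi> = 0"
  shows "growth (stable_orbit c \<xi>)"
  unfolding growth_def
proof (intro conjI exI allI impI)
  show "stable_orbit c \<xi> \<in> borel_measurable borel"
    using c by (intro measurable_path) (simp add: scaling_def)
  show "norm (stable_orbit c \<xi> t) \<le> K * norm \<xi> / (1 - contraction) * exp (\<eta> * t)" if "0 \<le> t" for t
    using picard_limit[OF c \<xi> that, of 0] by simp
qed

lemma stable_orbit_fixed_point:
  assumes c: "scaling c" and \<xi>: "Pp \<xi> = 0" and t: "0 \<le> t"
  shows "lp_operator c \<xi> (stable_orbit c \<xi>) t = stable_orbit c \<xi> t"
proof -
  define B where "B = K * norm \<xi> / (1 - contraction)"
  have le: "norm (lp_operator c \<xi> (stable_orbit c \<xi>) t - stable_orbit c \<xi> t)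
      \<le> 2 * B * contraction ^ Suc n * exp (\<eta> * t)" for n
  proof -
    have "norm (lp_operator c \<xi> (stable_orbit c \<xi>) t - lp_operator c \<xi> (picard c \<xi> n) t)
      \<le> (K * norm (\<xi> - \<xi>) + contraction * (B * contraction ^ n)) * exp (\<eta> * t)"
      using picard_limit[OF c \<xi>] picard_step[OF c \<xi>]
      by (intro lp_operator_diff[OF c stable_orbit_growth[OF c \<xi>] _ \<xi> \<xi> _ t]) (auto simp: B_def)
    moreover have "norm (stable_orbit c \<xi> t - picard c \<xi> (Suc n) t) \<le> B * contraction ^ Suc n * exp (\<eta> * t)"
      unfolding B_def by (rule picard_limit[OF c \<xi> t])
    ultimately show ?thesis
      using norm_triangle_ineq4[of "lp_operator c \<xi> (stable_orbit c \<xi>) t - picard c \<xi> (Suc n) t"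
          "stable_orbit c \<xi> t - picard c \<xi> (Suc n) t"]
      by (simp add: algebra_simps)
  qed
  have "(\<lambda>n. 2 * B * contraction ^ Suc n * exp (\<eta> * t)) \<longlonglongrightarrow> 2 * B * 0 * exp (\<eta> * t)"
    using contraction_bounds
    by (intro tendsto_intros LIMSEQ_Suc LIMSEQ_power_zero) auto
  from LIMSEQ_le_const[OF this]
  have "norm (lp_operator c \<xi> (stable_orbit c \<xi>) t - stable_orbit c \<xi> t) \<le> 2 * B * 0 * exp (\<eta> * t)"
    using le by blast
  then show ?thesis by simp
qed

end

section \<open>Fixed points and mild solutions\<close>

context lyapunov_perron
begin

text \<open>This is the mild formulation for the unknown scaled by the integrated noise.\<close>

definition scaled_mild :: "(real \<Rightarrow> real) \<Rightarrow> 'a \<Rightarrow> (real \<Rightarrow> 'a) \<Rightarrow> bool" where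
  "scaled_mild c x v \<longleftrightarrow> (\<forall>t\<ge>0. v t = T t x +
     (LINT s|lborel. indicator {0<..<t} s *\<^sub>R T (t - s) (scaled_nonlin c s (v s))))"

text \<open>The unstable component that a solution must start from so that its exponentially growing part is
  exactly cancelled by the future forcing.\<close>

definition unstable_start :: "(real \<Rightarrow> real) \<Rightarrow> (real \<Rightarrow> 'a) \<Rightarrow> 'a" where
  "unstable_start c v = (LINT s|lborel. indicator {0<..} s *\<^sub>R green (- s) (scaled_nonlin c s (v s)))"

lemma green_neg: "0 < s \<Longrightarrow> green (- s) x = - unstable_flow (- s) x"
  by (simp add: green_def)

lemma Pp_unstable_start:
  assumes "scaling c" "growth v"
  shows "Pp (unstable_start c v) = unstable_start c v"
proof -
  have i: "integrable lborel (\<lambda>s. indicator {0<..} s *\<^sub>R green (- s) (scaled_nonlin c s (v s)))"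
    using integrable_green[OF assms, of 0] by simp
  have "Pp (indicator {0<..} s *\<^sub>R green (- s) x) = indicator {0<..} s *\<^sub>R green (- s) x" for s :: real and x
    by (cases "0 < s") (simp_all add: green_neg unstable_flow_range linear_neg linear_0 bounded_linear.linear[OF linear_Pp])
  with integral_bounded_linear[OF linear_Pp i] show ?thesis
    by (simp add: unstable_start_def)
qed

text \<open>Splitting the Green integral at time \<open>t\<close> and moving the future part to time \<open>0\<close> turns the
  Lyapunov--Perron operator into the variation of constants formula with a corrected initial value.
  Everything about mild solutions of moderate growth follows from this identity.\<close>

lemma lp_operator_variation_of_constants:
  assumes c: "scaling c" and v: "growth v" and t: "0 \<le> t"
  shows "lp_operator c \<xi> v t = T t (\<xi> + unstable_start c v) +
     (LINT s|lborel. indicator {0<..<t} s *\<^sub>R T (t - s) (scaled_nonlin c s (v s)))"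
proof -
  let ?n = "\<lambda>s. scaled_nonlin c s (v s)"
  let ?g = "\<lambda>s. indicator {0<..} s *\<^sub>R green (t - s) (?n s)"
  let ?u = "\<lambda>s. indicator {0<..} s *\<^sub>R green (- s) (?n s)"
  let ?m = "\<lambda>s. indicator {0<..<t} s *\<^sub>R T (t - s) (?n s)"
  have lin: "linear (T t)" using linear_T[OF t] by (rule bounded_linear.linear)
  have gi: "integrable lborel ?g" by (rule integrable_green[OF c v])
  have ui: "integrable lborel ?u" using integrable_green[OF c v, of 0] by simp
  \<comment> \<open>The future part of the Green integral cancels against the transported correction; at \<open>s = t\<close> the
    Green function takes its stable value, and the identity fails there.\<close>
  have split: "?g s - T t (?u s) = ?m s" if "s \<noteq> t" for s
  proof (cases "0 < s")
    case True
    then show ?thesis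
    proof (cases "s < t")
      case less: True
      have "T (t - s) (?n s) = T (t - s) (?n s - Pp (?n s)) + T (t - s) (Pp (?n s))"
        using linear_add[OF bounded_linear.linear[OF linear_T], of "t - s" "?n s - Pp (?n s)" "Pp (?n s)"] less
        by simp
      moreover have "T t (unstable_flow (- s) (?n s)) = T (t - s) (Pp (?n s))"
        using True less by (intro T_unstable_flow) auto
      ultimately show ?thesis
        using True less by (simp add: green_neg linear_neg[OF lin]) (simp add: green_def stable_flow_def)
    next
      case False
      then have "T t (unstable_flow (- s) (?n s)) = unstable_flow (t - s) (?n s)"
        using t by (intro unstable_flow_shift) auto
      then show ?thesis
        using True False that by (simp add: green_neg linear_neg[OF lin]) (simp add: green_def)
    qed
  qed (simp add: linear_0[OF lin])
  have Tu: "has_bochner_integral lborel (\<lambda>s. T t (?u s)) (T t (unstable_start c v))"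
    using has_bochner_integral_bounded_linear[OF linear_T[OF t] has_bochner_integral_integrable[OF ui]]
    by (simp add: unstable_start_def)
  have d: "has_bochner_integral lborel (\<lambda>s. ?g s - T t (?u s))
      (integral\<^sup>L lborel ?g - T t (unstable_start c v))"
    by (rule has_bochner_integral_diff[OF has_bochner_integral_integrable[OF gi] Tu])
  have "(LINT s|lborel. ?m s) = (LINT s|lborel. ?g s - T t (?u s))"
  proof (rule integral_cong_AE)
    show ae: "AE s in lborel. ?m s = ?g s - T t (?u s)"
      using AE_lborel_singleton[of t] by eventually_elim (simp add: split)
    show "(\<lambda>s. ?g s - T t (?u s)) \<in> borel_measurable lborel" using d by (rule borel_measurable_has_bochner_integral)
    have "?m = (\<lambda>s. if s = t then 0 else ?g s - T t (?u s))"
    proof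
      fix s show "?m s = (if s = t then 0 else ?g s - T t (?u s))"
        by (cases "s = t") (simp_all add: split)
    qed
    moreover have "(\<lambda>s. if s = t then 0 else ?g s - T t (?u s)) \<in> borel_measurable lborel"
      using borel_measurable_has_bochner_integral[OF d]
      by (intro measurable_If) auto
    ultimately show "?m \<in> borel_measurable lborel" by simp
  qed
  also have "\<dots> = integral\<^sup>L lborel ?g - T t (unstable_start c v)"
    using d by (rule has_bochner_integral_integral_eq)
  finally show ?thesis
    using t by (simp add: lp_operator_def linear_add[OF lin])
qed

lemma lp_fixed_point_mild:
  assumes "scaling c" "growth v" "\<And>t. 0 \<le> t \<Longrightarrow> lp_operator c \<xi> v t = v t"
  shows "v 0 = \<xi> + unstable_start c v" "scaled_mild c (v 0) v"
proof -
  show v0: "v 0 = \<xi> + unstable_start c v"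
    using lp_operator_variation_of_constants[OF assms(1,2), of 0 \<xi>] assms(3)[of 0] by (simp add: T_0)
  show "scaled_mild c (v 0) v"
    unfolding scaled_mild_def v0
    using lp_operator_variation_of_constants[OF assms(1,2)] assms(3) by simp
qed

text \<open>The dichotomy bounds the backward flow on the unstable subspace by \<open>exp (- \<alpha> * t)\<close>, so a nonzero
  forward orbit there grows at least like \<open>exp (\<alpha> * t)\<close>, faster than \<open>exp (\<eta> * t)\<close>.\<close>

lemma unstable_orbit_zero:
  assumes "Pp y = y" and C: "\<And>t. 0 \<le> t \<Longrightarrow> norm (T t y) \<le> C * exp (\<eta> * t)"
  shows "y = 0"
proof -
  have "norm y \<le> K * C * exp (- ((\<alpha> - \<eta>) * t))" if "0 \<le> t" for t
  proof -
    have "norm y = norm (unstable_flow (- t) (T t y))"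
      using unstable_flow_T[OF that] assms(1) by simp
    also have "\<dots> \<le> K * exp (\<alpha> * - t) * norm (Pp (T t y))"
      using that by (intro norm_unstable_flow) simp
    also have "\<dots> \<le> K * exp (\<alpha> * - t) * (C * exp (\<eta> * t))"
      using C[OF that] K_nonneg that assms(1) by (intro mult_left_mono) (auto simp: Pp_T)
    also have "\<dots> = K * C * exp (- ((\<alpha> - \<eta>) * t))"
      by (simp add: algebra_simps flip: exp_add)
    finally show ?thesis .
  qed
  moreover have "((\<lambda>t. K * C * exp (- ((\<alpha> - \<eta>) * t))) \<longlongrightarrow> K * C * 0) at_top"
    using rate
    by (intro tendsto_intros filterlim_compose[OF exp_at_bot] filterlim_uminus_at_bot[THEN iffD2])
      (auto intro!: filterlim_tendsto_pos_mult_at_top[OF tendsto_const] filterlim_ident)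
  ultimately have "norm y \<le> K * C * 0"
    by (intro tendsto_lowerbound[of _ _ at_top]) (auto simp: eventually_at_top_linorder intro!: exI[of _ 0])
  then show ?thesis by simp
qed

text \<open>A mild solution and its image under the operator have the same forcing, so they differ by an orbit
  of the linear equation. The operator keeps the stable component of the initial value, so this orbit is
  unstable; it has moderate growth because both paths do, and hence it vanishes.\<close>

lemma mild_lp_fixed_point:
  assumes c: "scaling c" and v: "growth v" and m: "scaled_mild c x v" and t: "0 \<le> t"
  shows "lp_operator c (x - Pp x) v t = v t"
proof -
  define y where "y = Pp x - unstable_start c v"
  define w where "w = lp_operator c (x - Pp x) v"
  have Py: "Pp y = y"
    by (simp add: y_def linear_diff[OF bounded_linear.linear[OF linear_Pp]] Pp_idem Pp_unstable_start[OF c v])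
  have vw: "v t - w t = T t y" if "0 \<le> t" for t
  proof -
    have "v t - w t = T t x - T t (x - Pp x + unstable_start c v)"
      using lp_operator_variation_of_constants[OF c v that, of "x - Pp x"] m that
      by (simp add: scaled_mild_def w_def)
    also have "\<dots> = T t (x - (x - Pp x + unstable_start c v))"
      by (rule linear_diff[OF bounded_linear.linear[OF linear_T[OF that]], symmetric])
    finally show ?thesis by (simp add: y_def algebra_simps)
  qed
  obtain C where C: "\<And>t. 0 \<le> t \<Longrightarrow> norm (v t) \<le> C * exp (\<eta> * t)"
    using growthE[OF v] by blast
  have z: "growth (\<lambda>_. 0)" by (auto simp: growth_def intro!: exI[of _ 0])
  have w: "norm (w t) \<le> (K * norm (x - Pp x) + contraction * C) * exp (\<eta> * t)" if "0 \<le> t" for t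
  proof -
    have "lp_operator c 0 (\<lambda>_. 0) t = 0"
      using that by (simp add: lp_operator_def scaled_nonlin_0 linear_0[OF bounded_linear.linear[OF linear_green]]
          linear_0[OF bounded_linear.linear[OF linear_T]])
    then show ?thesis
      using lp_operator_diff[OF c v z Pp_Pm, of 0 C t x] C that
      by (simp add: w_def linear_0[OF bounded_linear.linear[OF linear_Pp]])
  qed
  \<comment> \<open>The growth bound on \<open>w\<close> comes from comparing it with the trivial fixed point at \<open>0\<close>.\<close>
  have "y = 0"
  proof (rule unstable_orbit_zero[OF Py])
    show "norm (T t y) \<le> (C + (K * norm (x - Pp x) + contraction * C)) * exp (\<eta> * t)" if "0 \<le> t" for t
      using norm_triangle_ineq4[of "v t" "w t"] C[OF that] w[OF that] vw[OF that]
      by (simp add: algebra_simps)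
  qed
  then show ?thesis
    using vw[OF t] linear_0[OF bounded_linear.linear[OF linear_T[OF t]]] by (simp add: w_def)
qed

text \<open>The Green function jumps at \<open>0\<close> only, which is invisible to the integral, and its decay rates at
  nearby times differ by a bounded factor; so the integral depends continuously on time by dominated
  convergence.\<close>

lemma continuous_lp_operator:
  assumes c: "scaling c" and v: "growth v"
  shows "continuous_on UNIV (lp_operator c \<xi> v)"
proof -
  define m where "m = max \<bar>\<alpha>\<bar> \<bar>\<beta>\<bar>"
  obtain C where C: "\<And>t. 0 \<le> t \<Longrightarrow> norm (v t) \<le> C * exp (\<eta> * t)"
    using growthE[OF v] by blast
  have C0: "0 \<le> C" using order_trans[OF norm_ge_zero C[of 0]] by simp
  let ?k = "\<lambda>t s. min (exp (\<alpha> * (t - s))) (exp (\<beta> * (t - s)))"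
  let ?f = "\<lambda>t s. indicator {0<..} s *\<^sub>R green (t - s) (scaled_nonlin c s (v s))"
  have cm: "c \<in> borel_measurable borel" "v \<in> borel_measurable borel"
    using c v by (auto simp: scaling_def growth_def)
  have "(\<lambda>n. LINT s|lborel. ?f (\<tau> n) s) \<longlonglongrightarrow> (LINT s|lborel. ?f t s)" if \<tau>: "\<tau> \<longlonglongrightarrow> t" for \<tau> t
  proof -
    obtain N where N: "\<And>n. n \<ge> N \<Longrightarrow> \<bar>\<tau> n - t\<bar> \<le> 1"
      using LIMSEQ_D[OF \<tau>, of 1] by (auto intro: less_imp_le)
    have "(\<lambda>n. LINT s|lborel. ?f (\<tau> (n + N)) s) \<longlonglongrightarrow> (LINT s|lborel. ?f t s)"
    proof (rule integral_dominated_convergence[where w = "\<lambda>s. K * L * C * exp m * (?k t s * exp (\<eta> * s))"])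
      show "integrable lborel (\<lambda>s. K * L * C * exp m * (?k t s * exp (\<eta> * s)))"
        using has_bochner_integral_dichotomy_rate[OF rate, of t]
        by (intro integrable_mult_right) (simp add: has_bochner_integral_iff)
      show "AE s in lborel. (\<lambda>n. ?f (\<tau> (n + N)) s) \<longlonglongrightarrow> ?f t s"
        using AE_lborel_singleton[of t]
      proof eventually_elim
        case (elim s)
        have "(\<lambda>n. \<tau> (n + N) - s) \<longlonglongrightarrow> t - s"
          by (intro tendsto_intros LIMSEQ_ignore_initial_segment \<tau>)
        from isCont_tendsto_compose[OF isCont_green this] elim
        show ?case by (intro tendsto_intros) auto
      qed
      show "AE s in lborel. norm (?f (\<tau> (n + N)) s) \<le> K * L * C * exp m * (?k t s * exp (\<eta> * s))" for n
      proof (rule AE_I2)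
        fix s :: real
        let ?r = "\<tau> (n + N)"
        have a: "a * (?r - s) \<le> m + a * (t - s)" if "\<bar>a\<bar> \<le> m" for a
        proof -
          have "\<bar>a * (?r - t)\<bar> \<le> m"
            using mult_mono[of "\<bar>a\<bar>" m "\<bar>?r - t\<bar>" 1] that N[of "n + N"] by (simp add: abs_mult)
          moreover have "a * (?r - s) = a * (?r - t) + a * (t - s)" by (simp add: algebra_simps)
          ultimately show ?thesis by linarith
        qed
        have "?k ?r s \<le> min (exp m * exp (\<alpha> * (t - s))) (exp m * exp (\<beta> * (t - s)))"
          using a[of \<alpha>] a[of \<beta>] by (intro min.mono) (auto simp: m_def simp flip: exp_add)
        also have "\<dots> = exp m * ?k t s" by (simp add: min_mult_distrib_left)
        finally have k: "?k ?r s \<le> exp m * ?k t s" .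
        show "norm (?f ?r s) \<le> K * L * C * exp m * (?k t s * exp (\<eta> * s))"
        proof (cases "0 < s")
          case True
          have "norm (?f ?r s) \<le> K * L * C * (?k ?r s * exp (\<eta> * s))"
            using norm_green_scaled_nonlin_diff[OF c, of "v s" 0 C s ?r] C[of s] True
            by (simp add: scaled_nonlin_0 linear_0[OF bounded_linear.linear[OF linear_green]])
          also have "\<dots> \<le> K * L * C * ((exp m * ?k t s) * exp (\<eta> * s))"
            using k K_nonneg L_pos C0 by (intro mult_left_mono mult_right_mono) auto
          finally show ?thesis by (simp add: mult_ac)
        qed (use K_nonneg L_pos C0 in simp)
      qed
    qed (use measurable_green_scaled_nonlin[OF cm] in simp_all)
    then show ?thesis by (rule LIMSEQ_offset)
  qed
  then have "continuous_on UNIV (\<lambda>t. LINT s|lborel. ?f t s)"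
    by (auto simp: continuous_on_sequentially comp_def)
  then show ?thesis
    unfolding lp_operator_def by (intro continuous_on_add continuous_T_max)
qed

section \<open>The stable manifold of the scaled equation\<close>

definition stable_graph :: "(real \<Rightarrow> real) \<Rightarrow> 'a \<Rightarrow> 'a" where
  "stable_graph c \<xi> = stable_orbit c \<xi> 0 - \<xi>"

lemma stable_graph_range:
  assumes "scaling c" "Pp \<xi> = 0"
  shows "Pp (stable_graph c \<xi>) = stable_graph c \<xi>"
proof -
  have "stable_graph c \<xi> = unstable_start c (stable_orbit c \<xi>)"
    using lp_fixed_point_mild(1)[OF assms(1) stable_orbit_growth[OF assms] stable_orbit_fixed_point[OF assms]]
    by (simp add: stable_graph_def)
  then show ?thesis using Pp_unstable_start[OF assms(1) stable_orbit_growth[OF assms]] by simp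
qed

lemma stable_graph_lipschitz:
  assumes c: "scaling c"
  shows "(K / (1 - contraction) + 1)-lipschitz_on {\<xi>. Pp \<xi> = 0} (stable_graph c)"
proof (rule lipschitz_onI)
  fix \<xi> \<zeta> assume "\<xi> \<in> {\<xi>. Pp \<xi> = 0}" "\<zeta> \<in> {\<xi>. Pp \<xi> = 0}"
  then have p: "Pp \<xi> = 0" "Pp \<zeta> = 0" by auto
  have "norm (stable_orbit c \<xi> 0 - stable_orbit c \<zeta> 0) \<le> K * norm (\<xi> - \<zeta>) / (1 - contraction)"
    using lp_fixed_point_lipschitz[OF c stable_orbit_growth[OF c p(1)] stable_orbit_growth[OF c p(2)] p
        stable_orbit_fixed_point[OF c p(1)] stable_orbit_fixed_point[OF c p(2)], of 0] by simp
  then show "dist (stable_graph c \<xi>) (stable_graph c \<zeta>) \<le> (K / (1 - contraction) + 1) * dist \<xi> \<zeta>"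
    using norm_triangle_ineq4[of "stable_orbit c \<xi> 0 - stable_orbit c \<zeta> 0" "\<xi> - \<zeta>"]
    by (simp add: stable_graph_def dist_norm algebra_simps)
qed (use K_nonneg contraction_bounds in simp)

lemma stable_graph_0:
  assumes "scaling c"
  shows "stable_graph c 0 = 0"
proof -
  have p: "Pp 0 = 0" by (rule linear_0[OF bounded_linear.linear[OF linear_Pp]])
  have "norm (stable_orbit c 0 0) \<le> 0"
    using picard_limit[OF assms p, of 0 0] by simp
  then show ?thesis by (simp add: stable_graph_def)
qed

lemma stable_orbit_mild:
  assumes "scaling c" "Pp \<xi> = 0"
  shows "scaled_mild c (\<xi> + stable_graph c \<xi>) (stable_orbit c \<xi>)"
    "continuous_on {0..} (stable_orbit c \<xi>)"
proof -
  note fixed = assms(1) stable_orbit_growth[OF assms] stable_orbit_fixed_point[OF assms]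
  show "scaled_mild c (\<xi> + stable_graph c \<xi>) (stable_orbit c \<xi>)"
    using lp_fixed_point_mild(2)[OF fixed] by (simp add: stable_graph_def)
  show "continuous_on {0..} (stable_orbit c \<xi>)"
    using continuous_on_subset[OF continuous_lp_operator[OF fixed(1,2), of \<xi>] subset_UNIV]
    by (rule continuous_on_eq) (simp add: fixed(3))
qed

text \<open>The start of any moderately growing solution lies on the graph, since its scaled path is the unique
  fixed point over the stable component of \<open>x\<close>.\<close>

lemma stable_graph_unique:
  assumes c: "scaling c" and v: "growth v" and m: "scaled_mild c x v" 
  shows "x = (x - Pp x) + stable_graph c (x - Pp x)"
proof -
  note p = Pp_Pm[of x]
  have "norm (v 0 - stable_orbit c (x - Pp x) 0) \<le> K * norm ((x - Pp x) - (x - Pp x)) / (1 - contraction) * exp (\<eta> * 0)"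
    by (rule lp_fixed_point_lipschitz[OF c v stable_orbit_growth[OF c p] p p
        mild_lp_fixed_point[OF c v m] stable_orbit_fixed_point[OF c p]]) auto
  moreover have "v 0 = x"
    using m by (simp add: scaled_mild_def T_0)
  ultimately show ?thesis by (simp add: stable_graph_def)
qed

lemma measurable_stable_graph:
  assumes "(\<lambda>(\<omega>, s). c \<omega> s) \<in> borel_measurable (M \<Otimes>\<^sub>M borel)"
  shows "(\<lambda>\<omega>. stable_graph (c \<omega>) \<xi>) \<in> borel_measurable M"
proof -
  have "(\<lambda>\<omega>. (\<omega>, 0 :: real)) \<in> M \<rightarrow>\<^sub>M (M \<Otimes>\<^sub>M borel)" by measurable
  from measurable_compose[OF this measurable_stable_orbit[OF assms]]
  show ?thesis unfolding stable_graph_def by (intro borel_measurable_diff) auto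
qed

end

section \<open>The stationary noise and its integral\<close>

text \<open>The integrated noise comes from the removal of the term \<open>z u\<close>, and the noise itself from the
  conjugated nonlinearity. Negative times are irrelevant, and cutting them off lets the signed integral be
  written as an integral over a set.\<close>

definition noise_scaling :: "(real \<Rightarrow> real) \<Rightarrow> real \<Rightarrow> real" where
  "noise_scaling \<omega> s = exp (ou_integral \<omega> 0 (max 0 s) + ou (wiener_shift s \<omega>))"

lemma wiener_shift_shift: "wiener_shift r (wiener_shift t \<omega>) = wiener_shift (t + r) \<omega>"
  by (simp add: wiener_shift_def algebra_simps)

lemma wiener_shift_in:
  assumes "admissible_noise W \<Omega>" "\<omega> \<in> \<Omega>"
  shows "wiener_shift t \<omega> \<in> \<Omega>"
  using assms by (auto simp: admissible_noise_def)

text \<open>A single point is compact, so the sets that generate the compact-open topology include the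
  cylinders over open sets.\<close>

lemma measurable_coordinate:
  assumes "wiener_measure W"
  shows "(\<lambda>\<omega>. \<omega> t) \<in> borel_measurable W"
proof (rule borel_measurableI)
  fix S :: "real set" assume "open S"
  have top: "topspace compact_open_C0 \<subseteq> C0_paths"
    unfolding compact_open_C0_def topology_generated_by_topspace by blast
  have "openin compact_open_C0 {\<omega> \<in> C0_paths. \<omega> ` {t} \<subseteq> S}"
    unfolding compact_open_C0_def
    by (rule topology_generated_by_Basis) (use \<open>open S\<close> in \<open>blast intro: compact_sing\<close>)
  moreover have "{U. openin compact_open_C0 U} \<subseteq> Pow C0_paths"
    using top openin_subset by blast
  ultimately have "{\<omega> \<in> C0_paths. \<omega> ` {t} \<subseteq> S} \<in> sets borel_C0"
    unfolding borel_C0_def by (auto intro: sigma_sets.Basic)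
  then show "(\<lambda>\<omega>. \<omega> t) -` S \<inter> space W \<in> sets W"
    using assms by (auto simp: wiener_measure_def vimage_def Int_def conj_commute)
qed

lemma space_noise:
  assumes "wiener_measure W" "admissible_noise W \<Omega>"
  shows "space (restrict_space W \<Omega>) = \<Omega>" "\<And>\<omega>. \<omega> \<in> \<Omega> \<Longrightarrow> continuous_on UNIV \<omega>"
proof -
  have "\<Omega> \<subseteq> space W" using assms(2) by (auto simp: admissible_noise_def dest: sets.sets_into_space)
  then show "space (restrict_space W \<Omega>) = \<Omega>" "\<And>\<omega>. \<omega> \<in> \<Omega> \<Longrightarrow> continuous_on UNIV \<omega>"
    using assms(1) by (auto simp: space_restrict_space wiener_measure_def C0_paths_def)
qed

lemma ou_set_integral:
  "ou \<omega> = - (LINT \<tau>|lborel. indicator {..<0} \<tau> *\<^sub>R (exp \<tau> * \<omega> \<tau>))"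
proof -
  have "einterval (- \<infinity>) 0 = {..<0}" by (auto simp: einterval_def)
  then show ?thesis by (simp add: ou_def interval_lebesgue_integral_def set_lebesgue_integral_def)
qed

lemma ou_integral_set_integral:
  assumes "0 \<le> t"
  shows "ou_integral \<omega> 0 t = (LINT r|lborel. indicator {0<..<t} r *\<^sub>R ou (wiener_shift r \<omega>))"
  using assms by (simp add: ou_integral_def interval_lebesgue_integral_def set_lebesgue_integral_def)

text \<open>For the coordinate process \<open>e\<close> this is the stationary noise as a function of time and path: a
  parameter integral of a jointly measurable function.\<close>

lemma measurable_exp_average:
  fixes e :: "real \<Rightarrow> 'x \<Rightarrow> real"
  assumes [measurable]: "(\<lambda>(t, x). e t x) \<in> borel_measurable (borel \<Otimes>\<^sub>M M)"
  shows "(\<lambda>(r, x). - (LINT \<tau>|lborel. indicator {..<0} \<tau> *\<^sub>R (exp \<tau> * (e (\<tau> + r) x - e r x))))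
    \<in> borel_measurable (borel \<Otimes>\<^sub>M M)"
proof -
  have [measurable]: "sets lborel = sets borel" by simp
  have "(\<lambda>p. LINT \<tau>|lborel. indicator {..<0} \<tau> *\<^sub>R (exp \<tau> * (e (\<tau> + fst p) (snd p) - e (fst p) (snd p))))
      \<in> borel_measurable (borel \<Otimes>\<^sub>M M)"
    by (rule lborel.borel_measurable_lebesgue_integral) measurable
  then show ?thesis unfolding case_prod_unfold by measurable
qed

lemma measurable_noise_scaling:
  assumes W: "wiener_measure W" and \<Omega>: "admissible_noise W \<Omega>"
  shows "(\<lambda>(\<omega>, s). noise_scaling \<omega> s) \<in> borel_measurable (restrict_space W \<Omega> \<Otimes>\<^sub>M borel)"
proof -
  define P where "P = restrict_space W \<Omega>"
  have "(\<lambda>(t, \<omega>). \<omega> t) \<in> borel_measurable (borel \<Otimes>\<^sub>M P)"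
    unfolding P_def
    by (rule measurable_caratheodory)
      (use measurable_restrict_space1[OF measurable_coordinate[OF W]] space_noise[OF W \<Omega>] in auto)
  from measurable_exp_average[OF this]
  have [measurable]: "(\<lambda>(r, \<omega>). ou (wiener_shift r \<omega>)) \<in> borel_measurable (borel \<Otimes>\<^sub>M P)"
    by (simp add: ou_set_integral wiener_shift_def)
  have [measurable]: "sets lborel = sets borel" by simp
  have "(\<lambda>p. LINT r|lborel. (if 0 < r \<and> r < max 0 (snd p) then 1 else 0) *\<^sub>R ou (wiener_shift r (fst p)))
      \<in> borel_measurable (P \<Otimes>\<^sub>M borel)"
    by (rule lborel.borel_measurable_lebesgue_integral) measurable
  moreover have "ou_integral (fst p) 0 (max 0 (snd p))
      = (LINT r|lborel. (if 0 < r \<and> r < max 0 (snd p) then 1 else 0) *\<^sub>R ou (wiener_shift r (fst p)))"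
    for p :: "(real \<Rightarrow> real) \<times> real"
    by (subst ou_integral_set_integral) (auto simp: indicator_def intro!: Bochner_Integration.integral_cong)
  ultimately have [measurable]: "(\<lambda>p. ou_integral (fst p) 0 (max 0 (snd p))) \<in> borel_measurable (P \<Otimes>\<^sub>M borel)"
    by simp
  show ?thesis
    unfolding noise_scaling_def case_prod_unfold P_def[symmetric] by measurable
qed

lemma ou_integral_has_derivative:
  assumes "admissible_noise W \<Omega>" "\<omega> \<in> \<Omega>"
  shows "((\<lambda>t. ou_integral \<omega> 0 t) has_vector_derivative ou (wiener_shift t \<omega>)) (at t)"
proof -
  define b where "b = \<bar>t\<bar> + 1"
  have c: "continuous_on {-b..b} (\<lambda>r. ou (wiener_shift r \<omega>))"
    using assms by (auto simp: admissible_noise_def intro: continuous_on_subset)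
  have "((\<lambda>u. LBINT y=0..u. ou (wiener_shift y \<omega>)) has_vector_derivative ou (wiener_shift t \<omega>))
      (at t within {-b..b})"
    using interval_integral_FTC2[of "-b" 0 b "\<lambda>r. ou (wiener_shift r \<omega>)" t] c
    by (simp add: b_def zero_ereal_def)
  then show ?thesis
    by (subst (asm) at_within_Icc_at) (auto simp: b_def ou_integral_def zero_ereal_def)
qed

text \<open>The noise at time \<open>r\<close> of the path shifted by \<open>q\<close> is the noise at time \<open>q + r\<close>, so both sides are
  increments of the same antiderivative.\<close>

lemma ou_integral_diff:
  assumes "admissible_noise W \<Omega>" "\<omega> \<in> \<Omega>"
  shows "ou_integral (wiener_shift q \<omega>) s t = ou_integral \<omega> 0 (q + t) - ou_integral \<omega> 0 (q + s)"
proof -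
  have eq: "ou_integral (wiener_shift q \<omega>) s t = (LBINT r=ereal s..ereal t. ou (wiener_shift (q + r) \<omega>))"
    by (simp add: ou_integral_def wiener_shift_shift)
  show ?thesis unfolding eq
  proof (rule interval_integral_FTC_finite)
    have "continuous_on UNIV (\<lambda>t. ou (wiener_shift t \<omega>))"
      using assms by (simp add: admissible_noise_def)
    then show "continuous_on {min s t..max s t} (\<lambda>r. ou (wiener_shift (q + r) \<omega>))"
      by (rule continuous_on_compose2) (auto intro!: continuous_intros)
    fix r
    have "((\<lambda>r. ou_integral \<omega> 0 r) \<circ> (\<lambda>r. q + r) has_vector_derivative 1 *\<^sub>R ou (wiener_shift (q + r) \<omega>)) (at r)"
      by (rule vector_diff_chain_at)
        (auto intro!: ou_integral_has_derivative[OF assms] derivative_eq_intros)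
    then show "((\<lambda>r. ou_integral \<omega> 0 (q + r)) has_vector_derivative ou (wiener_shift (q + r) \<omega>))
        (at r within {min s t..max s t})"
      by (simp add: comp_def has_vector_derivative_at_within)
  qed
qed

lemma ou_integral_additive:
  assumes "admissible_noise W \<Omega>" "\<omega> \<in> \<Omega>"
  shows "ou_integral \<omega> s t = ou_integral \<omega> 0 t - ou_integral \<omega> 0 s"
proof -
  have "ou_integral (wiener_shift 0 \<omega>) s t = ou_integral \<omega> s t"
    by (simp add: ou_integral_def wiener_shift_shift)
  then show ?thesis using ou_integral_diff[OF assms, of 0 s t] by simp
qed

lemma continuous_ou_integral:
  assumes "admissible_noise W \<Omega>" "\<omega> \<in> \<Omega>"
  shows "continuous_on S (\<lambda>t. ou_integral \<omega> 0 t)"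
  using ou_integral_has_derivative[OF assms]
  by (intro continuous_at_imp_continuous_on ballI has_vector_derivative_continuous)

section \<open>Removing the linear noise term\<close>

text \<open>The path is frozen at negative times, so that continuity on \<open>[0, \<infinity>)\<close> makes it measurable on the
  whole line.\<close>

definition descale :: "(real \<Rightarrow> real) \<Rightarrow> (real \<Rightarrow> 'a::real_normed_vector) \<Rightarrow> real \<Rightarrow> 'a" where
  "descale \<omega> \<phi> t = exp (- ou_integral \<omega> 0 (max 0 t)) *\<^sub>R \<phi> (max 0 t)"

context lyapunov_perron
begin

lemma scaling_noise_scaling:
  assumes "wiener_measure W" "admissible_noise W \<Omega>" "\<omega> \<in> \<Omega>"
  shows "scaling (noise_scaling \<omega>)"
proof -
  have "Pair \<omega> \<in> borel \<rightarrow>\<^sub>M (restrict_space W \<Omega> \<Otimes>\<^sub>M borel)"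
    using assms space_noise(1)[OF assms(1,2)] by (intro measurable_Pair1') simp
  from measurable_compose[OF this measurable_noise_scaling[OF assms(1,2)]]
  have "noise_scaling \<omega> \<in> borel_measurable borel" by simp
  moreover have "0 < noise_scaling \<omega> s" for s by (simp add: noise_scaling_def)
  ultimately show ?thesis by (simp add: scaling_def)
qed

text \<open>The semigroup commutes with the scalar factors, so the equation is multiplied through by the
  exponential of minus the integrated noise up to time \<open>t\<close>; at time \<open>s\<close> under the integral, additivity
  leaves the factor up to \<open>s\<close>, which combines with that of the conjugated nonlinearity.\<close>

lemma mild_solution_iff:
  assumes \<Omega>: "admissible_noise W \<Omega>" "\<omega> \<in> \<Omega>"
  shows "mild_solution T F \<omega> x \<phi> \<longleftrightarrow>
    continuous_on {0..} \<phi> \<and> scaled_mild (noise_scaling \<omega>) x (descale \<omega> \<phi>)"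
proof -
  define \<Phi> where "\<Phi> = ou_integral \<omega> 0"
  have "(\<phi> t = exp (ou_integral \<omega> 0 t) *\<^sub>R T t x
        + (LBINT s=0..ereal t.
             exp (ou_integral \<omega> s t) *\<^sub>R T (t - s) (conj_nonlin F (wiener_shift s \<omega>) (\<phi> s))))
     \<longleftrightarrow> (descale \<omega> \<phi> t = T t x + (LINT s|lborel. indicator {0<..<t} s *\<^sub>R
             T (t - s) (scaled_nonlin (noise_scaling \<omega>) s (descale \<omega> \<phi> s))))"
    (is "(_ = _ + ?I) \<longleftrightarrow> (_ = _ + ?J)") if t: "0 \<le> t" for t
  proof -
    have "?I = (LINT s|lborel. indicator {0<..<t} s *\<^sub>R
        (exp (ou_integral \<omega> s t) *\<^sub>R T (t - s) (conj_nonlin F (wiener_shift s \<omega>) (\<phi> s))))"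
      using t by (simp add: interval_lebesgue_integral_def set_lebesgue_integral_def zero_ereal_def)
    also have "\<dots> = (LINT s|lborel. exp (\<Phi> t) *\<^sub>R (indicator {0<..<t} s *\<^sub>R
             T (t - s) (scaled_nonlin (noise_scaling \<omega>) s (descale \<omega> \<phi> s))))"
    proof (rule Bochner_Integration.integral_cong)
      fix s :: real
      show "indicator {0<..<t} s *\<^sub>R
          (exp (ou_integral \<omega> s t) *\<^sub>R T (t - s) (conj_nonlin F (wiener_shift s \<omega>) (\<phi> s)))
        = exp (\<Phi> t) *\<^sub>R (indicator {0<..<t} s *\<^sub>R
             T (t - s) (scaled_nonlin (noise_scaling \<omega>) s (descale \<omega> \<phi> s)))"
      proof (cases "0 < s \<and> s < t")
        case True
        let ?z = "ou (wiener_shift s \<omega>)"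
        have lin: "linear (T (t - s))" using True linear_T by (simp add: bounded_linear.linear)
        have "noise_scaling \<omega> s *\<^sub>R descale \<omega> \<phi> s = exp ?z *\<^sub>R \<phi> s"
          using True by (simp add: noise_scaling_def descale_def flip: exp_add)
        then have "scaled_nonlin (noise_scaling \<omega>) s (descale \<omega> \<phi> s)
            = exp (- \<Phi> s) *\<^sub>R conj_nonlin F (wiener_shift s \<omega>) (\<phi> s)"
          using True by (simp add: scaled_nonlin_def noise_scaling_def conj_nonlin_def \<Phi>_def
              exp_add exp_minus mult.commute)
        then show ?thesis
          using True ou_integral_additive[OF \<Omega>, of s t]
          by (simp add: linear_scale[OF lin] \<Phi>_def exp_diff exp_minus divide_inverse)
      qed auto
    qed simp
    also have "\<dots> = exp (\<Phi> t) *\<^sub>R ?J"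
      by (rule Bochner_Integration.integral_scaleR_right)
    finally have I: "?I = exp (\<Phi> t) *\<^sub>R ?J" .
    have \<phi>: "\<phi> t = exp (\<Phi> t) *\<^sub>R descale \<omega> \<phi> t"
      using t by (simp add: descale_def \<Phi>_def flip: exp_add)
    have "exp (ou_integral \<omega> 0 t) *\<^sub>R T t x + exp (\<Phi> t) *\<^sub>R ?J = exp (\<Phi> t) *\<^sub>R (T t x + ?J)"
      by (simp add: \<Phi>_def scaleR_add_right)
    then show ?thesis unfolding I by (subst \<phi>) simp
  qed
  then show ?thesis by (auto simp: mild_solution_def scaled_mild_def)
qed

lemma measurable_descale:
  assumes "admissible_noise W \<Omega>" "\<omega> \<in> \<Omega>" "continuous_on {0..} \<phi>"
  shows "descale \<omega> \<phi> \<in> borel_measurable borel"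
proof -
  have "continuous_on UNIV (descale \<omega> \<phi>)" unfolding descale_def
    by (intro continuous_on_scaleR continuous_on_exp continuous_on_minus
        continuous_on_compose2[OF continuous_ou_integral[OF assms(1,2), of UNIV]]
        continuous_on_compose2[OF assms(3)] continuous_intros) auto
  then show ?thesis by (rule borel_measurable_continuous_onI)
qed

lemma C_eta_plus_iff:
  assumes "admissible_noise W \<Omega>" "\<omega> \<in> \<Omega>" "continuous_on {0..} \<phi>"
  shows "\<phi> \<in> C_eta_plus \<eta> \<omega> \<longleftrightarrow> growth (descale \<omega> \<phi>)"
proof -
  have "exp (- \<eta> * t - ou_integral \<omega> 0 t) * norm (\<phi> t) \<le> C
      \<longleftrightarrow> norm (descale \<omega> \<phi> t) \<le> C * exp (\<eta> * t)" if "0 \<le> t" for t C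
    using that by (simp add: descale_def exp_diff exp_minus field_simps)
  then show ?thesis
    using assms(3) measurable_descale[OF assms] by (auto simp: C_eta_plus_def growth_def bdd_above_def)
qed

text \<open>The set of initial values whose solution grows at most like \<open>exp (\<eta> * t)\<close> is a graph: an initial
  value in it is the start of a Lyapunov--Perron fixed point, and conversely each fixed point is, after
  rescaling, the solution that starts there.\<close>

lemma moderate_growth_graph:
  assumes W: "wiener_measure W" and \<Omega>: "admissible_noise W \<Omega>" "\<omega> \<in> \<Omega>"
    and u: "\<And>x. unique_mild_solution T F \<omega> x (\<lambda>t. u t x)"
  shows "{x. (\<lambda>t. u t x) \<in> C_eta_plus \<eta> \<omega>}
    = {\<xi> + stable_graph (noise_scaling \<omega>) \<xi> | \<xi>. Pp \<xi> = 0}"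
proof (intro set_eqI iffI)
  note c = scaling_noise_scaling[OF W \<Omega>]
  have mild: "mild_solution T F \<omega> x (\<lambda>t. u t x)" for x
    using u by (simp add: unique_mild_solution_def)
  have cont: "continuous_on {0..} (\<lambda>t. u t x)" for x
    using mild by (simp add: mild_solution_def)
  {
    fix x assume "x \<in> {x. (\<lambda>t. u t x) \<in> C_eta_plus \<eta> \<omega>}"
    then have "growth (descale \<omega> (\<lambda>t. u t x))" using C_eta_plus_iff[OF \<Omega> cont] by simp
    moreover have "scaled_mild (noise_scaling \<omega>) x (descale \<omega> (\<lambda>t. u t x))"
      using mild_solution_iff[OF \<Omega>] mild by blast
    ultimately have "x = (x - Pp x) + stable_graph (noise_scaling \<omega>) (x - Pp x)"
      by (rule stable_graph_unique[OF c])
    then show "x \<in> {\<xi> + stable_graph (noise_scaling \<omega>) \<xi> | \<xi>. Pp \<xi> = 0}"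
      using Pp_Pm[of x] by blast
  }
  fix x assume "x \<in> {\<xi> + stable_graph (noise_scaling \<omega>) \<xi> | \<xi>. Pp \<xi> = 0}"
  then obtain \<xi> where \<xi>: "Pp \<xi> = 0" and x: "x = \<xi> + stable_graph (noise_scaling \<omega>) \<xi>" by blast
  define v where "v = stable_orbit (noise_scaling \<omega>) \<xi>"
  define \<phi> where "\<phi> = (\<lambda>t. exp (ou_integral \<omega> 0 t) *\<^sub>R v t)"
  have v: "continuous_on {0..} v" "scaled_mild (noise_scaling \<omega>) x v" "growth v"
    unfolding v_def x using stable_orbit_mild[OF c \<xi>] stable_orbit_growth[OF c \<xi>] by auto
  have \<phi>: "continuous_on {0..} \<phi>"
    unfolding \<phi>_def by (intro continuous_intros continuous_ou_integral[OF \<Omega>] v)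
  have dv: "descale \<omega> \<phi> t = v t" if "0 \<le> t" for t
    using that by (simp add: descale_def \<phi>_def flip: exp_add)
  have "scaled_mild (noise_scaling \<omega>) x (descale \<omega> \<phi>)"
    unfolding scaled_mild_def
  proof (intro allI impI)
    fix t :: real assume "0 \<le> t"
    have "(LINT s|lborel. indicator {0<..<t} s *\<^sub>R T (t - s) (scaled_nonlin (noise_scaling \<omega>) s (descale \<omega> \<phi> s)))
      = (LINT s|lborel. indicator {0<..<t} s *\<^sub>R T (t - s) (scaled_nonlin (noise_scaling \<omega>) s (v s)))"
      by (rule Bochner_Integration.integral_cong) (auto simp: indicator_def dv)
    then show "descale \<omega> \<phi> t = T t x + (LINT s|lborel. indicator {0<..<t} s *\<^sub>R
        T (t - s) (scaled_nonlin (noise_scaling \<omega>) s (descale \<omega> \<phi> s)))"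
      using v(2) \<open>0 \<le> t\<close> by (simp add: dv scaled_mild_def)
  qed
  with \<phi> have "mild_solution T F \<omega> x \<phi>" using mild_solution_iff[OF \<Omega>] by blast
  then have eq: "\<phi> t = u t x" if "0 \<le> t" for t
    using u[of x] that by (simp add: unique_mild_solution_def)
  have "growth (descale \<omega> (\<lambda>t. u t x))"
  proof -
    have "descale \<omega> (\<lambda>t. u t x) = descale \<omega> \<phi>" by (auto simp: descale_def eq)
    then show ?thesis
      using v(3) dv measurable_descale[OF \<Omega> \<phi>] by (simp add: growth_def)
  qed
  then show "x \<in> {x. (\<lambda>t. u t x) \<in> C_eta_plus \<eta> \<omega>}" using C_eta_plus_iff[OF \<Omega> cont] by simp
qed

end

section \<open>The random stable manifold\<close>

text \<open>The distance to \<open>g y\<close> is continuous in \<open>y\<close>, so a lower bound on a dense set is a lower bound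
  everywhere.\<close>

lemma infdist_range_dense:
  fixes g :: "'b::topological_space \<Rightarrow> 'c::metric_space"
  assumes g: "continuous_on UNIV g" and dense: "\<And>X. open X \<Longrightarrow> X \<noteq> {} \<Longrightarrow> \<exists>d\<in>D. d \<in> X"
  shows "infdist x (range g) = (INF y\<in>D. dist x (g y))"
proof -
  have D: "D \<noteq> {}" using dense[of UNIV] by auto
  have bdd: "bdd_below ((\<lambda>y. dist x (g y)) ` S)" for S by (rule bdd_belowI2[of _ 0]) simp
  have inf: "infdist x (range g) = (INF y. dist x (g y))"
    by (simp add: infdist_def image_image)
  let ?S = "{y. (INF y\<in>D. dist x (g y)) \<le> dist x (g y)}"
  have "closed ?S" by (intro closed_Collect_le continuous_intros g)
  then have "open (- ?S)" by (rule open_Compl)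
  moreover have "\<not> (\<exists>d\<in>D. d \<in> - ?S)" using bdd by (auto intro: cINF_lower)
  ultimately have "- ?S = {}" using dense by blast
  then have "(INF y\<in>D. dist x (g y)) \<le> (INF y. dist x (g y))"
    by (intro cINF_greatest) auto
  moreover have "(INF y. dist x (g y)) \<le> (INF y\<in>D. dist x (g y))"
    using D bdd by (intro cINF_superset_mono) auto
  ultimately show ?thesis by (simp add: inf)
qed

context lyapunov_perron
begin

lemma continuous_graph_map:
  assumes "scaling c"
  shows "continuous_on UNIV (\<lambda>y. (y - Pp y) + stable_graph c (y - Pp y))"
proof -
  have P: "continuous_on UNIV (\<lambda>y. y - Pp y)"
    by (intro continuous_on_diff continuous_on_id linear_continuous_on linear_Pp)
  then show ?thesis
    by (intro continuous_on_add continuous_on_compose2[OF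
          lipschitz_on_continuous_on[OF stable_graph_lipschitz[OF assms]]]) (auto simp: Pp_Pm)
qed

lemma graph_eq_range:
  "{\<xi> + stable_graph c \<xi> | \<xi>. Pp \<xi> = 0} = range (\<lambda>y. (y - Pp y) + stable_graph c (y - Pp y))"
proof (intro set_eqI iffI)
  fix x assume "x \<in> {\<xi> + stable_graph c \<xi> | \<xi>. Pp \<xi> = 0}"
  then obtain \<xi> where "Pp \<xi> = 0" "x = \<xi> + stable_graph c \<xi>" by blast
  then have "x = (\<xi> - Pp \<xi>) + stable_graph c (\<xi> - Pp \<xi>)" by simp
  then show "x \<in> range (\<lambda>y. (y - Pp y) + stable_graph c (y - Pp y))" by blast
qed (use Pp_Pm in blast)

text \<open>The projection recovers the base point, so the graph is the set of fixed points of a continuous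
  map.\<close>

lemma closed_graph:
  assumes c: "scaling c"
  shows "closed {\<xi> + stable_graph c \<xi> | \<xi>. Pp \<xi> = 0}"
proof -
  have "{\<xi> + stable_graph c \<xi> | \<xi>. Pp \<xi> = 0} = {x. (x - Pp x) + stable_graph c (x - Pp x) = x}"
  proof (intro set_eqI iffI)
    fix x assume "x \<in> {\<xi> + stable_graph c \<xi> | \<xi>. Pp \<xi> = 0}"
    then obtain \<xi> where \<xi>: "Pp \<xi> = 0" and x: "x = \<xi> + stable_graph c \<xi>" by blast
    have "Pp x = stable_graph c \<xi>"
      unfolding x by (simp add: linear_add[OF bounded_linear.linear[OF linear_Pp]] \<xi> stable_graph_range[OF c \<xi>])
    then have "x - Pp x = \<xi>" by (simp add: x)
    then show "x \<in> {x. (x - Pp x) + stable_graph c (x - Pp x) = x}" by (simp add: x)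
  next
    fix x assume "x \<in> {x. (x - Pp x) + stable_graph c (x - Pp x) = x}"
    then have "x = (x - Pp x) + stable_graph c (x - Pp x)" by simp
    then show "x \<in> {\<xi> + stable_graph c \<xi> | \<xi>. Pp \<xi> = 0}" using Pp_Pm by blast
  qed
  then show ?thesis
    using closed_Collect_eq[OF continuous_graph_map[OF c] continuous_on_id] by (simp only:)
qed

text \<open>The distance to the graph is an infimum over a countable dense set of base points, because the
  graph is a continuous image of the space.\<close>

lemma measurable_infdist_graph:
  assumes c: "(\<lambda>(\<omega>, s). c \<omega> s) \<in> borel_measurable (M \<Otimes>\<^sub>M borel)"
    and sc: "\<And>\<omega>. \<omega> \<in> space M \<Longrightarrow> scaling (c \<omega>)"
  shows "(\<lambda>\<omega>. infdist x {\<xi> + stable_graph (c \<omega>) \<xi> | \<xi>. Pp \<xi> = 0}) \<in> borel_measurable M"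
proof -
  obtain D :: "'a set" where D: "countable D" "\<And>X. open X \<Longrightarrow> X \<noteq> {} \<Longrightarrow> \<exists>d\<in>D. d \<in> X"
    using countable_dense_exists by blast
  have "(\<lambda>\<omega>. INF y\<in>D. dist x ((y - Pp y) + stable_graph (c \<omega>) (y - Pp y))) \<in> borel_measurable M"
    using D(1) by (intro borel_measurable_cINF_real borel_measurable_dist borel_measurable_add
        measurable_stable_graph[OF c]) auto
  moreover have "infdist x {\<xi> + stable_graph (c \<omega>) \<xi> | \<xi>. Pp \<xi> = 0}
      = (INF y\<in>D. dist x ((y - Pp y) + stable_graph (c \<omega>) (y - Pp y)))" if "\<omega> \<in> space M" for \<omega>
    unfolding graph_eq_range by (rule infdist_range_dense[OF continuous_graph_map[OF sc[OF that]] D(2)])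
  ultimately show ?thesis by (simp cong: measurable_cong)
qed

end

text \<open>The integrated noise of the shifted path is an increment, so the two weights differ by a factor that
  depends on the shift alone.\<close>

lemma C_eta_plus_shift:
  assumes \<Omega>: "admissible_noise W \<Omega>" "\<omega> \<in> \<Omega>" and t: "0 \<le> t"
    and \<phi>: "\<phi> \<in> C_eta_plus \<eta> \<omega>" and \<psi>: "continuous_on {0..} \<psi>" "\<And>s. 0 \<le> s \<Longrightarrow> \<psi> s = \<phi> (t + s)"
  shows "\<psi> \<in> C_eta_plus \<eta> (wiener_shift t \<omega>)"
proof -
  obtain C where C: "\<And>s. 0 \<le> s \<Longrightarrow> exp (- \<eta> * s - ou_integral \<omega> 0 s) * norm (\<phi> s) \<le> C"
    using \<phi> by (auto simp: C_eta_plus_def bdd_above_def)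
  have "exp (- \<eta> * s - ou_integral (wiener_shift t \<omega>) 0 s) * norm (\<psi> s)
      \<le> exp (\<eta> * t + ou_integral \<omega> 0 t) * C" if "0 \<le> s" for s
  proof -
    have "- \<eta> * s - ou_integral (wiener_shift t \<omega>) 0 s
        = (\<eta> * t + ou_integral \<omega> 0 t) + (- \<eta> * (t + s) - ou_integral \<omega> 0 (t + s))"
      using ou_integral_diff[OF \<Omega>, of t 0 s] by (simp add: algebra_simps)
    then have "exp (- \<eta> * s - ou_integral (wiener_shift t \<omega>) 0 s) * norm (\<psi> s)
        = exp (\<eta> * t + ou_integral \<omega> 0 t) * (exp (- \<eta> * (t + s) - ou_integral \<omega> 0 (t + s)) * norm (\<phi> (t + s)))"
      using \<psi>(2)[OF that] by (simp only: exp_add mult.assoc)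
    also have "\<dots> \<le> exp (\<eta> * t + ou_integral \<omega> 0 t) * C"
      using C[of "t + s"] t that by (intro mult_left_mono) auto
    finally show ?thesis .
  qed
  then show ?thesis using \<psi>(1) by (auto simp: C_eta_plus_def intro!: bdd_aboveI2)
qed

theorem theorem3p1:
  fixes A :: "'a::{real_inner,banach,second_countable_topology} \<Rightarrow> 'a"
    and D :: "'a set"
    and T :: "real \<Rightarrow> 'a \<Rightarrow> 'a"
    and Pp Pm F :: "'a \<Rightarrow> 'a"
    and \<alpha> \<beta> \<eta> K L :: real
    and W :: "(real \<Rightarrow> real) measure"
    and \<Omega> :: "(real \<Rightarrow> real) set"
    and u :: "real \<Rightarrow> (real \<Rightarrow> real) \<Rightarrow> 'a \<Rightarrow> 'a"
  assumes infinite_dim: "\<And>B :: 'a set. finite B \<Longrightarrow> span B \<noteq> UNIV"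
    and generator: "generates_semigroup D A T"
    and dichotomy: "exponential_dichotomy T Pp \<alpha> \<beta> K"
    and Pm: "\<And>x. Pm x = x - Pp x"
    and F0: "F 0 = 0"
    and Lip_pos: "L > 0"
    and Lip_p: "\<And>x y. norm (Pp (F x - F y)) \<le> L * norm (x - y)"
    and Lip_m: "\<And>x y. norm (Pm (F x - F y)) \<le> L * norm (x - y)"
    and wiener: "wiener_measure W"
    and noise: "admissible_noise W \<Omega>"
    and solution: "\<And>\<omega> x. \<omega> \<in> \<Omega> \<Longrightarrow> unique_mild_solution T F \<omega> x (\<lambda>t. u t \<omega> x)"
    and rds: "random_dynamical_system (restrict_space W \<Omega>) u"
    and eta: "\<beta> < \<eta>" "\<eta> < \<alpha>"
    and gap: "K * L * (1 / (\<eta> - \<beta>) + 1 / (\<alpha> - \<eta>)) < 1"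
  shows "\<exists>Ms hs.
           lipschitz_stable_manifold (restrict_space W \<Omega>) u (range Pm) (range Pp) hs Ms \<and>
           (\<forall>\<omega>\<in>\<Omega>. Ms \<omega> = {x. (\<lambda>t. u t \<omega> x) \<in> C_eta_plus \<eta> \<omega>} \<and> hs 0 \<omega> = 0)"
proof -
  have semigroup: "C0_semigroup T" using generator by (simp add: generates_semigroup_def)
  \<comment> \<open>A nonzero vector exists, and the stable estimate at time \<open>0\<close> then forces \<open>K \<ge> 0\<close>.\<close>
  have "0 \<le> K"
  proof -
    obtain x :: 'a where "x \<noteq> 0" using infinite_dim[of "{}"] by auto
    have "norm (T 0 (x - Pp x)) \<le> K * exp (\<beta> * 0) * norm x"
      using dichotomy unfolding exponential_dichotomy_def by (metis order_refl)
    from order_trans[OF norm_ge_zero this] show ?thesis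
      using \<open>x \<noteq> 0\<close> by (simp add: zero_le_mult_iff)
  qed
  interpret lyapunov_perron T Pp \<alpha> \<beta> K F L \<eta>
    using semigroup dichotomy \<open>0 \<le> K\<close> F0 Lip_pos Lip_p Lip_m eta gap
    by unfold_locales (auto simp: Pm)
  let ?P = "restrict_space W \<Omega>"
  note sp = space_noise[OF wiener noise]
  define hs where "hs = (\<lambda>\<xi> \<omega>. stable_graph (noise_scaling \<omega>) \<xi>)"
  define Ms where "Ms = (\<lambda>\<omega>. {\<xi> + hs \<xi> \<omega> | \<xi>. Pp \<xi> = 0})"
  have Hm: "range Pm = {\<xi>. Pp \<xi> = 0}"
  proof -
    have "\<xi> \<in> range Pm" if "Pp \<xi> = 0" for \<xi>
      using that Pm[of \<xi>] by (intro image_eqI[of _ _ \<xi>]) auto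
    moreover have "Pp (Pm x) = 0" for x by (simp add: Pm Pp_Pm)
    ultimately show ?thesis by blast
  qed
  have c: "scaling (noise_scaling \<omega>)" if "\<omega> \<in> \<Omega>" for \<omega>
    by (rule scaling_noise_scaling[OF wiener noise that])
  have Ms: "Ms \<omega> = {x. (\<lambda>t. u t \<omega> x) \<in> C_eta_plus \<eta> \<omega>}" if "\<omega> \<in> \<Omega>" for \<omega>
    unfolding Ms_def hs_def using moderate_growth_graph[OF wiener noise that solution[OF that]] by simp
  have "random_set ?P Ms"
    unfolding random_set_def
  proof (intro conjI ballI allI)
    show "Ms \<omega> \<noteq> {}" for \<omega> using linear_0[OF bounded_linear.linear[OF linear_Pp]] by (auto simp: Ms_def)
    show "closed (Ms \<omega>)" if "\<omega> \<in> space ?P" for \<omega>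
      using closed_graph[OF c] that by (simp add: Ms_def hs_def sp)
    show "(\<lambda>\<omega>. infdist x (Ms \<omega>)) \<in> borel_measurable ?P" for x
      unfolding Ms_def hs_def
      by (rule measurable_infdist_graph[OF measurable_noise_scaling[OF wiener noise]]) (simp add: sp c)
  qed
  moreover have "invariant_under ?P u Ms"
    unfolding invariant_under_def
  proof (intro allI impI ballI image_subsetI)
    fix t :: real and \<omega> x assume t: "0 \<le> t" and "\<omega> \<in> space ?P" and x: "x \<in> Ms \<omega>"
    then have \<omega>: "\<omega> \<in> \<Omega>" by (simp add: sp)
    note \<omega>' = wiener_shift_in[OF noise \<omega>, of t]
    have "(\<lambda>s. u s (wiener_shift t \<omega>) (u t \<omega> x)) \<in> C_eta_plus \<eta> (wiener_shift t \<omega>)"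
    proof (rule C_eta_plus_shift[OF noise \<omega> t])
      show "(\<lambda>t. u t \<omega> x) \<in> C_eta_plus \<eta> \<omega>" using x Ms[OF \<omega>] by simp
      show "continuous_on {0..} (\<lambda>s. u s (wiener_shift t \<omega>) (u t \<omega> x))"
        using solution[OF \<omega>'] by (simp add: unique_mild_solution_def mild_solution_def)
      show "u s (wiener_shift t \<omega>) (u t \<omega> x) = u (t + s) \<omega> x" if "0 \<le> s" for s
        using rds t that \<omega> by (simp add: random_dynamical_system_def sp)
    qed
    then show "u t \<omega> x \<in> Ms (wiener_shift t \<omega>)" using Ms[OF \<omega>'] by simp
  qed
  moreover have "hs \<xi> \<omega> \<in> range Pp" if "\<omega> \<in> \<Omega>" "\<xi> \<in> range Pm" for \<omega> \<xi>
    using stable_graph_range[OF c[OF that(1)]] that(2) by (simp add: hs_def Hm range_Pp_iff)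
  moreover have "\<exists>L. L-lipschitz_on (range Pm) (\<lambda>\<xi>. hs \<xi> \<omega>)" if "\<omega> \<in> \<Omega>" for \<omega>
    using stable_graph_lipschitz[OF c[OF that]] unfolding hs_def Hm by blast
  ultimately have "lipschitz_stable_manifold ?P u (range Pm) (range Pp) hs Ms"
    by (auto simp: lipschitz_stable_manifold_def sp Ms_def Hm)
  then show ?thesis using Ms stable_graph_0[OF c]
    by (intro exI[of _ Ms] exI[of _ hs]) (auto simp: hs_def)
qed

end
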